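(* Let $\Gamma$ be a countably infinite group, $n\in\mathbb N$, and let $f\in M_n(\mathbb Z\Gamma)$ be positively row lopsided. Let $\nu$ be a probability measure on $S_f$ such that for every $j\in\{1,\dots,n\}$ its marginal distribution on the $j$-th factor $\{0,\dots,|M_j|-1\}$ of $S_f$ is the uniform probability measure. Then the set $$\{y\in S_f^\Gamma : |\phi_f^{-1}(\phi_f(y))\cap S_f^\Gamma|>1\}$$ has $\nu^\Gamma$-measure $0$. Consequently, $\phi_f$ (restricted to $S_f^\Gamma$) is a measure conjugacy between the shift action $\Gamma\curvearrowright(S_f^\Gamma,\nu^\Gamma)$ and $\Gamma\curvearrowright (X_f,(\phi_f)_*\nu^\Gamma)$, i.e. it is a $\Gamma$-equivariant measurable map which is injective on a $\Gamma$-invariant $\nu^\Gamma$-conull set.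
   Context: $\mathbb Z\Gamma$ is the integral group ring: finitely supported $f:\Gamma\to\mathbb Z$, written $f=\sum_s f_s s$, with product $(fg)_t=\sum_{s}f_{ts^{-1}}g_s$ and involution $(f^* )_s=f_{s^{-1}}$; $\mathrm{supp}(f)=\{s:f_s\neq0\}$. $\ell^1_{\mathbb R}(\Gamma)$, $\ell^\infty_{\mathbb R}(\Gamma)$ are the absolutely summable/bounded real functions on $\Gamma$, with the same convolution formula for products. For $f=(f^{(km)})_{k,m\in[n]}\in M_n(\ell^1_{\mathbb R}(\Gamma))$, $(f^* )^{(km)}=(f^{(mk)})^*$, and $\|f\|_{1,\infty}=\max_m\sum_k\|f^{(km)}\|_1$. Elements $x$ of $((\mathbb R/\mathbb Z)^\Gamma)^n$, of $(\ell^\infty_{\mathbb R}(\Gamma))^n$ or of $(\mathbb Z\Gamma)^n$ are regarded as row vectors $x=(x_1,\dots,x_n)$ with entries $x_{s,k}=(x_k)_s$, and for a matrix $F$ over $\mathbb Z\Gamma$ or $\ell^1_{\mathbb R}(\Gamma)$, $(xF)_m=\sum_k x_kF^{(km)}$ with the convolution above. $X_f=\{x\in((\mathbb R/\mathbb Z)^\Gamma)^n: xf^*=0\}$ (the Pontryagin dual of $(\mathbb Z\Gamma)^n/(\mathbb Z\Gamma)^nf$), a compact abelian group with $\Gamma$ acting by the left shift $(sx)_{t,k}=x_{s^{-1}t,k}$; $\mu_{X_f}$ is its normalized Haar measure. When $f$ is invertible in $M_n(\ell^1_{\mathbb R}(\Gamma))$, the map $\phi_f$ is defined on $(\mathbb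 Z^n)^\Gamma\cap(\ell^\infty_{\mathbb R}(\Gamma))^n$ by $\phi_f(y)=\pi(y(f^* )^{-1})$, where $\pi:(\mathbb R^\Gamma)^n\to((\mathbb R/\mathbb Z)^\Gamma)^n$ is the quotient map; its values lie in $X_f$ and its restriction to $S^\Gamma$ for finite $S\subseteq\mathbb Z^n$ is continuous and $\Gamma$-equivariant (shift action $(sy)_t=y_{s^{-1}t}$). Row/column lopsided: $f\in M_n(\mathbb Z\Gamma)$ is row lopsided if $f=M-g$ with $M,g\in M_n(\mathbb Z\Gamma)$, $\mathrm{supp}(M)\cap\mathrm{supp}(g)=\emptyset$ (supports as subsets of $\Gamma\times[n]^2$), $M=\mathrm{diag}(M_1s_1,\dots,M_ns_n)$ with $s_k\in\Gamma$, $M_k\in\mathbb Z$, and $|M_k|>\sum_{m\in[n]}\|g^{(km)}\|_1$ for each $k$; column lopsided if instead $|M_k|>\sum_{m}\|g^{(mk)}\|_1$ for each $k$; lopsided if both. It is positively row (resp. column) lopsided if moreover there is a right-invariant partial order $\le$ on $\Gamma$ ($s\le t\iff s\gamma\le t\gamma$) with $s_m<t$ for all $m\in[n]$ and all $t\in\bigcup_{k}\mathrm{supp}(g^{(km)})$ (equivalently a subsemigroup $P\subseteq\Gamma\setminus\{e_\Gamma\}$ containing $\bigcup_{k,m}\mathrm{supp}(g^{(km)}s_m^{-1})$); positively lopsided if both positively row and positively column lopsided. For such $f$, $S_f=\prod_{k\in[n]}\{0,\dots,|M_k|-1\}\subseteq\mathbb Z^n$. Row or column lopsided matrices are invertible in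 $M_n(\ell^1_{\mathbb R}(\Gamma))$. $\nu^\Gamma$ is the product measure on $S_f^\Gamma$. *)

theory Defs
  imports "HOL-Probability.Probability"
begin

text \<open>Conventions. The group \<Gamma> is a type 'g of class group_add, written additively:
  product s t is s + t, inverse is - s, identity is 0, so t s^-1 is t - s and s^-1 t is - s + t.
  Matrices over Z\<Gamma> are functions nat => nat => 'g => int (entry (k,m) evaluated at a group element),
  only indices k, m < n are relevant. The circle R/Z is represented by [0,1) via frac.\<close>

definition supp :: "('g \<Rightarrow> 'a::zero) \<Rightarrow> 'g set" where
  "supp a = {t. a t \<noteq> 0}"

definition conv :: "('g::group_add \<Rightarrow> real) \<Rightarrow> ('g \<Rightarrow> real) \<Rightarrow> 'g \<Rightarrow> real" where
  "conv a b t = (\<Sum>\<^sub>\<infinity>s. a (t - s) * b s)"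

definition l1 :: "('g \<Rightarrow> real) \<Rightarrow> bool" where
  "l1 a \<longleftrightarrow> (\<lambda>t. \<bar>a t\<bar>) summable_on UNIV"

definition matmul :: "nat \<Rightarrow> (nat \<Rightarrow> nat \<Rightarrow> 'g::group_add \<Rightarrow> real) \<Rightarrow> (nat \<Rightarrow> nat \<Rightarrow> 'g \<Rightarrow> real)
    \<Rightarrow> nat \<Rightarrow> nat \<Rightarrow> 'g \<Rightarrow> real" where
  "matmul n A B k m t = (\<Sum>j<n. conv (A k j) (B j m) t)"

definition idm :: "nat \<Rightarrow> nat \<Rightarrow> 'g::zero \<Rightarrow> real" where
  "idm k m t = (if k = m \<and> t = 0 then 1 else 0)"

definition is_l1_inverse :: "nat \<Rightarrow> (nat \<Rightarrow> nat \<Rightarrow> 'g::group_add \<Rightarrow> real) \<Rightarrow> (nat \<Rightarrow> nat \<Rightarrow> 'g \<Rightarrow> real) \<Rightarrow> bool" where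
  "is_l1_inverse n A B \<longleftrightarrow>
     (\<forall>k<n. \<forall>m<n. l1 (A k m) \<and> l1 (B k m)) \<and>
     (\<forall>k<n. \<forall>m<n. matmul n A B k m = idm k m) \<and>
     (\<forall>k<n. \<forall>m<n. matmul n B A k m = idm k m)"

definition star_mat :: "(nat \<Rightarrow> nat \<Rightarrow> 'g::group_add \<Rightarrow> int) \<Rightarrow> nat \<Rightarrow> nat \<Rightarrow> 'g \<Rightarrow> real" where
  "star_mat f k m t = real_of_int (f m k (- t))"

definition finv :: "nat \<Rightarrow> (nat \<Rightarrow> nat \<Rightarrow> 'g::group_add \<Rightarrow> int) \<Rightarrow> nat \<Rightarrow> nat \<Rightarrow> 'g \<Rightarrow> real" where
  "finv n f = (SOME B. is_l1_inverse n (star_mat f) B)"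

text \<open>phi_f(y) = pi(y (f^*)^{-1}); y : \<Gamma> => Z^n with y t k = y_{t,k}; result x with x k t = x_{t,k},
  values of R/Z represented in [0,1).\<close>
definition phi :: "nat \<Rightarrow> (nat \<Rightarrow> nat \<Rightarrow> 'g::group_add \<Rightarrow> int) \<Rightarrow> ('g \<Rightarrow> nat \<Rightarrow> int) \<Rightarrow> nat \<Rightarrow> 'g \<Rightarrow> real" where
  "phi n f y m t = (if m < n then
      frac (\<Sum>k<n. \<Sum>\<^sub>\<infinity>s. real_of_int (y (t - s) k) * finv n f k m s) else 0)"

text \<open>X_f = {x : x f^* = 0 in (R/Z)}, with x in [0,1) representation.\<close>
definition Xf :: "nat \<Rightarrow> (nat \<Rightarrow> nat \<Rightarrow> 'g::group_add \<Rightarrow> int) \<Rightarrow> (nat \<Rightarrow> 'g \<Rightarrow> real) set" where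
  "Xf n f = {x. (\<forall>k t. n \<le> k \<longrightarrow> x k t = 0) \<and> (\<forall>k t. 0 \<le> x k t \<and> x k t < 1) \<and>
      (\<forall>m<n. \<forall>t. (\<Sum>k<n. \<Sum>s\<in>{s. f m k (- s) \<noteq> 0}. x k (t - s) * real_of_int (f m k (- s))) \<in> \<int>)}"

definition pos_row_lopsided :: "nat \<Rightarrow> (nat \<Rightarrow> nat \<Rightarrow> 'g::group_add \<Rightarrow> int) \<Rightarrow> (nat \<Rightarrow> int) \<Rightarrow> (nat \<Rightarrow> 'g)
     \<Rightarrow> (nat \<Rightarrow> nat \<Rightarrow> 'g \<Rightarrow> int) \<Rightarrow> ('g \<Rightarrow> 'g \<Rightarrow> bool) \<Rightarrow> bool" where
  "pos_row_lopsided n f M s g le \<longleftrightarrow>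
     (\<forall>k<n. \<forall>m<n. finite (supp (f k m)) \<and> finite (supp (g k m))) \<and>
     (\<forall>k<n. \<forall>m<n. \<forall>t. f k m t = (if k = m \<and> t = s k then M k else 0) - g k m t) \<and>
     (\<forall>k<n. \<forall>m<n. \<forall>t. (k = m \<and> t = s k \<and> M k \<noteq> 0) \<longrightarrow> g k m t = 0) \<and>
     (\<forall>k<n. \<bar>M k\<bar> > (\<Sum>m<n. \<Sum>t\<in>supp (g k m). \<bar>g k m t\<bar>)) \<and>
     (\<forall>a. le a a) \<and> (\<forall>a b. le a b \<longrightarrow> le b a \<longrightarrow> a = b) \<and>
     (\<forall>a b c. le a b \<longrightarrow> le b c \<longrightarrow> le a c) \<and>
     (\<forall>a b c. le a b \<longleftrightarrow> le (a + c) (b + c)) \<and>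
     (\<forall>k<n. \<forall>m<n. \<forall>t\<in>supp (g k m). le (s m) t \<and> s m \<noteq> t)"

definition Sf :: "nat \<Rightarrow> (nat \<Rightarrow> int) \<Rightarrow> (nat \<Rightarrow> int) set" where
  "Sf n M = {v. (\<forall>k<n. 0 \<le> v k \<and> v k < \<bar>M k\<bar>) \<and> (\<forall>k. n \<le> k \<longrightarrow> v k = 0)}"

definition SfG :: "nat \<Rightarrow> (nat \<Rightarrow> int) \<Rightarrow> ('g \<Rightarrow> nat \<Rightarrow> int) set" where
  "SfG n M = (UNIV \<rightarrow> Sf n M)"

definition nuG :: "(nat \<Rightarrow> int) pmf \<Rightarrow> ('g \<Rightarrow> nat \<Rightarrow> int) measure" where
  "nuG \<nu> = PiM UNIV (\<lambda>_. measure_pmf \<nu>)"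

definition targetM :: "(nat \<Rightarrow> 'g \<Rightarrow> real) measure" where
  "targetM = PiM UNIV (\<lambda>_. PiM UNIV (\<lambda>_. borel))"

definition shiftY :: "'g::group_add \<Rightarrow> ('g \<Rightarrow> 'a) \<Rightarrow> 'g \<Rightarrow> 'a" where
  "shiftY \<gamma> y t = y (- \<gamma> + t)"

definition shiftX :: "'g::group_add \<Rightarrow> (nat \<Rightarrow> 'g \<Rightarrow> 'a) \<Rightarrow> nat \<Rightarrow> 'g \<Rightarrow> 'a" where
  "shiftX \<gamma> x k t = x k (- \<gamma> + t)"

end

(*
Write F for the adjoint matrix of f. Two configurations y, y' with the same image differ by z F for
the bounded integer vector z = (y - y') F^-1. At the entry (m, t) the equation y - z F = y' reads
  M_m z_m(t s_m) = y_m(t) - y'_m(t) + sum over k, u of g(m,k)_u z_k(t u).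
Put w_k(t) = z_k(t s_k). Then w_m(t) is an integer quotient by M_m computed from y_m(t), y'_m(t) and
the entries w_k(t u s_k^-1), where t u s_k^-1 lies strictly above t for the left-invariant order
generated by the positivity assumption. Starting from a constant bound |z| <= C and iterating i
times gives an upper bound for |w_m(t)| that depends on y alone. Since y_m(t) is uniform on
{0, ..., |M_m| - 1} and independent of the values of y at larger points, and since the average of
floor((v + a) / N) over 0 <= v < N is exactly a / N, the expectation of this bound shrinks by a
factor less than 1 in each step. Hence almost surely no nonzero z exists. The exceptional set is
measurable because the vectors z bounded by C form a compact set.
*)

theory Submission
  imports Defs
begin

section \<open>The inverse of a row lopsided matrix\<close>

lemma has_sum_sum:
  fixes f :: "'i \<Rightarrow> 'a \<Rightarrow> 'b::topological_comm_monoid_add"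
  assumes "finite I" "\<And>i. i \<in> I \<Longrightarrow> (f i has_sum a i) A"
  shows "((\<lambda>x. \<Sum>i\<in>I. f i x) has_sum (\<Sum>i\<in>I. a i)) A"
  using assms by (induction I) (auto intro: has_sum_add)

lemma has_sum_translate_right:
  fixes h :: "'g::group_add \<Rightarrow> 'b::topological_comm_monoid_add"
  shows "((\<lambda>t. h (t + c)) has_sum a) UNIV \<longleftrightarrow> (h has_sum a) UNIV"
  by (rule has_sum_reindex_bij_witness[of _ "\<lambda>t. t - c" "\<lambda>t. t + c"]) (auto simp: algebra_simps)

text \<open>The products x f^* for row vectors and f^* x for column vectors; the entry (j, m) of f^* at -u is f m j u.\<close>

definition right_star :: "nat \<Rightarrow> (nat \<Rightarrow> nat \<Rightarrow> 'g::group_add \<Rightarrow> int) \<Rightarrow> (nat \<Rightarrow> 'g \<Rightarrow> 'a::ring_1) \<Rightarrow> nat \<Rightarrow> 'g \<Rightarrow> 'a" where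
  "right_star n f x m t = (\<Sum>j<n. \<Sum>u\<in>supp (f m j). of_int (f m j u) * x j (t + u))"

definition left_star :: "nat \<Rightarrow> (nat \<Rightarrow> nat \<Rightarrow> 'g::group_add \<Rightarrow> int) \<Rightarrow> (nat \<Rightarrow> 'g \<Rightarrow> 'a::ring_1) \<Rightarrow> nat \<Rightarrow> 'g \<Rightarrow> 'a" where
  "left_star n f x k t = (\<Sum>j<n. \<Sum>u\<in>supp (f j k). of_int (f j k u) * x j (u + t))"

lemma group_add_reassoc: "v + (- a + (t - b + u)) = v + (- a + t) - b + (u::'g::group_add)"
  by (simp only: add.assoc diff_conv_add_uminus)
lemma diff_add_eq_iff: "t - a + u = b \<longleftrightarrow> u = a - t + (b::'g::group_add)"
proof -
  have "t - a + u = b \<longleftrightarrow> u = - (t - a) + b"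
    by (metis add_minus_cancel minus_add_cancel)
  then show ?thesis by simp
qed
lemma add_minus_add_eq_iff: "u + (- a + t) = b \<longleftrightarrow> u = b - t + (a::'g::group_add)"
proof -
  have "u + (- a + t) = b \<longleftrightarrow> u = b - (- a + t)"
    by (metis add_diff_cancel diff_add_cancel)
  then show ?thesis by (simp only: diff_conv_add_uminus minus_add minus_minus add.assoc)
qed

lemma sum_swap4:
  fixes F :: "'i \<Rightarrow> 'u \<Rightarrow> 'j \<Rightarrow> 'v \<Rightarrow> 'a::comm_monoid_add"
  shows "(\<Sum>j\<in>A. \<Sum>u\<in>S j. \<Sum>i\<in>B. \<Sum>v\<in>T i. F j u i v) = (\<Sum>i\<in>B. \<Sum>v\<in>T i. \<Sum>j\<in>A. \<Sum>u\<in>S j. F j u i v)"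
proof -
  have "(\<Sum>j\<in>A. \<Sum>u\<in>S j. \<Sum>i\<in>B. \<Sum>v\<in>T i. F j u i v) = (\<Sum>j\<in>A. \<Sum>i\<in>B. \<Sum>u\<in>S j. \<Sum>v\<in>T i. F j u i v)"
    by (rule sum.cong[OF refl], rule sum.swap)
  also have "\<dots> = (\<Sum>j\<in>A. \<Sum>i\<in>B. \<Sum>v\<in>T i. \<Sum>u\<in>S j. F j u i v)"
    by (rule sum.cong[OF refl], rule sum.cong[OF refl], rule sum.swap)
  also have "\<dots> = (\<Sum>i\<in>B. \<Sum>j\<in>A. \<Sum>v\<in>T i. \<Sum>u\<in>S j. F j u i v)"
    by (rule sum.swap)
  also have "\<dots> = (\<Sum>i\<in>B. \<Sum>v\<in>T i. \<Sum>j\<in>A. \<Sum>u\<in>S j. F j u i v)"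
    by (rule sum.cong[OF refl], rule sum.swap)
  finally show ?thesis .
qed

lemma infsum_supp:
  fixes F :: "'a \<Rightarrow> real" and w :: "'a \<Rightarrow> int"
  assumes "finite (supp w)"
  shows "(\<Sum>\<^sub>\<infinity>u. F u * real_of_int (w u)) = (\<Sum>u\<in>supp w. real_of_int (w u) * F u)"
proof -
  have "(\<Sum>\<^sub>\<infinity>u. F u * real_of_int (w u)) = (\<Sum>\<^sub>\<infinity>u\<in>supp w. real_of_int (w u) * F u)"
    by (rule infsum_cong_neutral) (auto simp: supp_def)
  then show ?thesis using assms by simp
qed

text \<open>The substitution s = -u turns convolution with an entry of F into a finite sum over the
  support of an entry of f. Infinite matrix products thereby become
  \<open>right_star\<close>.\<close>

lemma matmul_star_right:
  assumes "\<forall>j<n. finite (supp (f m j))"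
  shows "matmul n B (star_mat f) k m t = right_star n f (B k) m t"
  unfolding matmul_def right_star_def
proof (rule sum.cong)
  fix j assume "j \<in> {..<n}"
  then have fin: "finite (supp (f m j))" using assms by auto
  have "conv (B k j) (star_mat f j m) t = (\<Sum>\<^sub>\<infinity>u. B k j (t + u) * real_of_int (f m j u))"
    unfolding conv_def star_mat_def
    by (rule infsum_reindex_bij_witness[of _ uminus uminus]) auto
  then show "conv (B k j) (star_mat f j m) t = (\<Sum>u\<in>supp (f m j). real_of_int (f m j u) * B k j (t + u))"
    using infsum_supp[OF fin] by simp
qed simp

lemma matmul_star_left:
  assumes "\<forall>j<n. finite (supp (f j k))"
  shows "matmul n (star_mat f) B k m t = left_star n f (\<lambda>j. B j m) k t"
  unfolding matmul_def left_star_def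
proof (rule sum.cong)
  fix j assume "j \<in> {..<n}"
  then have fin: "finite (supp (f j k))" using assms by auto
  have "conv (star_mat f k j) (B j m) t = (\<Sum>\<^sub>\<infinity>u. B j m (u + t) * real_of_int (f j k u))"
    unfolding conv_def star_mat_def
    by (rule infsum_reindex_bij_witness[of _ "\<lambda>u. u + t" "\<lambda>s. s - t"])
       (auto simp: mult.commute)
  then show "conv (star_mat f k j) (B j m) t = (\<Sum>u\<in>supp (f j k). real_of_int (f j k u) * B j m (u + t))"
    using infsum_supp[OF fin] by simp
qed simp

section \<open>Lopsided matrices and the splitting of F into a diagonal part and a remainder\<close>

locale lopsided =
  fixes n :: nat and f g :: "nat \<Rightarrow> nat \<Rightarrow> 'g::{group_add, countable} \<Rightarrow> int"
    and M :: "nat \<Rightarrow> int" and s :: "nat \<Rightarrow> 'g" and le :: "'g \<Rightarrow> 'g \<Rightarrow> bool"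
  assumes lopsided: "pos_row_lopsided n f M s g le"
begin

lemma finite_supp: "k < n \<Longrightarrow> m < n \<Longrightarrow> finite (supp (f k m))" "k < n \<Longrightarrow> m < n \<Longrightarrow> finite (supp (g k m))"
  using lopsided[unfolded pos_row_lopsided_def, THEN conjunct1] by auto

lemma f_eq: "k < n \<Longrightarrow> m < n \<Longrightarrow> f k m t = (if k = m \<and> t = s k then M k else 0) - g k m t"
  using lopsided[unfolded pos_row_lopsided_def, THEN conjunct2, THEN conjunct1] by blast

lemma row_sum_less: "k < n \<Longrightarrow> (\<Sum>m<n. \<Sum>t\<in>supp (g k m). \<bar>g k m t\<bar>) < \<bar>M k\<bar>"
  using lopsided[unfolded pos_row_lopsided_def, THEN conjunct2, THEN conjunct2, THEN conjunct2, THEN conjunct1] by blast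

lemma le_refl: "le a a"
  using lopsided[unfolded pos_row_lopsided_def, THEN conjunct2, THEN conjunct2, THEN conjunct2, THEN conjunct2, THEN conjunct1] by blast

lemma le_antisym: "le a b \<Longrightarrow> le b a \<Longrightarrow> a = b"
  using lopsided[unfolded pos_row_lopsided_def, THEN conjunct2, THEN conjunct2, THEN conjunct2, THEN conjunct2, THEN conjunct2, THEN conjunct1] by blast

lemma le_trans: "le a b \<Longrightarrow> le b c \<Longrightarrow> le a c"
  using lopsided[unfolded pos_row_lopsided_def, THEN conjunct2, THEN conjunct2, THEN conjunct2, THEN conjunct2, THEN conjunct2, THEN conjunct2, THEN conjunct1] by blast

lemma le_add_right_iff: "le (a + c) (b + c) \<longleftrightarrow> le a b"
  using lopsided[unfolded pos_row_lopsided_def, THEN conjunct2, THEN conjunct2, THEN conjunct2, THEN conjunct2, THEN conjunct2, THEN conjunct2, THEN conjunct2, THEN conjunct1] by blast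

lemma less_supp: "k < n \<Longrightarrow> m < n \<Longrightarrow> t \<in> supp (g k m) \<Longrightarrow> le (s m) t \<and> s m \<noteq> t"
  using lopsided[unfolded pos_row_lopsided_def, THEN conjunct2, THEN conjunct2, THEN conjunct2, THEN conjunct2, THEN conjunct2, THEN conjunct2, THEN conjunct2, THEN conjunct2] by blast

lemma M_pos: "k < n \<Longrightarrow> 0 < \<bar>M k\<bar>"
  using row_sum_less[of k] by (smt (verit) sum_nonneg)

text \<open>All sums are compared on one finite set containing both supports and the diagonal point
  \<open>s m\<close>; the additional terms vanish.\<close>

lemma sum_supp_f:
  fixes F :: "'g \<Rightarrow> 'a::ring_1"
  assumes "m < n" "j < n"
  shows "(\<Sum>u\<in>supp (f m j). of_int (f m j u) * F u) =
    (if m = j then of_int (M m) * F (s m) else 0) - (\<Sum>u\<in>supp (g m j). of_int (g m j u) * F u)"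
proof -
  let ?T = "insert (s m) (supp (f m j) \<union> supp (g m j))"
  have fin: "finite ?T" using finite_supp assms by simp
  have "(\<Sum>u\<in>supp (f m j). of_int (f m j u) * F u) = (\<Sum>u\<in>?T. of_int (f m j u) * F u)"
    by (rule sum.mono_neutral_left) (use fin in \<open>auto simp: supp_def\<close>)
  also have "\<dots> = (\<Sum>u\<in>?T. (if u = s m then (if m = j then of_int (M m) * F u else 0) else 0) - of_int (g m j u) * F u)"
    by (rule sum.cong) (use assms in \<open>auto simp: f_eq algebra_simps\<close>)
  also have "\<dots> = (if m = j then of_int (M m) * F (s m) else 0) - (\<Sum>u\<in>?T. of_int (g m j u) * F u)"
    using fin by (subst sum_subtractf, subst sum.delta) auto
  also have "(\<Sum>u\<in>?T. of_int (g m j u) * F u) = (\<Sum>u\<in>supp (g m j). of_int (g m j u) * F u)"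
    by (rule sum.mono_neutral_right) (use fin in \<open>auto simp: supp_def\<close>)
  finally show ?thesis .
qed

lemma right_star_f:
  assumes "m < n"
  shows "right_star n f x m t = of_int (M m) * x m (t + s m) - right_star n g x m t"
  using assms unfolding right_star_def by (simp add: sum_supp_f sum_subtractf)

lemma left_star_f:
  assumes "k < n"
  shows "left_star n f x k t = of_int (M k) * x k (s k + t) - left_star n g x k t"
proof -
  have "left_star n f x k t = (\<Sum>j<n. (if j = k then of_int (M j) * x j (s j + t) else 0)
      - (\<Sum>u\<in>supp (g j k). of_int (g j k u) * x j (u + t)))"
    unfolding left_star_def
    by (rule sum.cong[OF refl], subst sum_supp_f) (use assms in auto)
  then show ?thesis using assms by (simp add: left_star_def sum_subtractf)
qed

lemma contraction_factor:
  "\<exists>\<rho>::real. 0 \<le> \<rho> \<and> \<rho> < 1 \<and> (\<forall>m<n. (\<Sum>j<n. \<Sum>u\<in>supp (g m j). \<bar>real_of_int (g m j u)\<bar>) \<le> \<rho> * \<bar>real_of_int (M m)\<bar>)"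
proof -
  let ?G = "\<lambda>m. (\<Sum>j<n. \<Sum>u\<in>supp (g m j). \<bar>real_of_int (g m j u)\<bar>)"
  \<comment> \<open>Finitely many ratios, each below 1. Inserting 0 keeps the set nonempty for n = 0
    and makes the factor nonnegative.\<close>
  define \<rho> where "\<rho> = Max (insert 0 ((\<lambda>m. ?G m / \<bar>real_of_int (M m)\<bar>) ` {..<n}))"
  have less: "?G m < \<bar>real_of_int (M m)\<bar>" if "m < n" for m
    using row_sum_less[OF that] by (simp flip: of_int_abs of_int_sum)
  have "?G m / \<bar>real_of_int (M m)\<bar> \<le> \<rho>" if "m < n" for m
    unfolding \<rho>_def using that by (intro Max_ge) auto
  then have "?G m \<le> \<rho> * \<bar>real_of_int (M m)\<bar>" if "m < n" for m
    using that M_pos[OF that] by (simp add: divide_le_eq)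
  moreover have "0 \<le> \<rho>" unfolding \<rho>_def by (intro Max_ge) auto
  moreover have "\<rho> < 1" unfolding \<rho>_def using less M_pos by (subst Max_less_iff) (auto simp: divide_less_eq)
  ultimately show ?thesis by blast
qed

text \<open>Write f^* = D - G with D diagonal and G = g^*. The terms D^-1 (G D^-1)^i of the Neumann series of
  the inverse equal (D^-1 G)^i D^-1, so their sum inverts f^* on both sides.\<close>

fun neumann :: "nat \<Rightarrow> nat \<Rightarrow> nat \<Rightarrow> 'g \<Rightarrow> real" where
  "neumann 0 k m t = (if k = m \<and> t = s k then 1 / of_int (M k) else 0)"
| "neumann (Suc i) k m t = right_star n g (neumann i k) m (t - s m) / of_int (M m)"

declare neumann.simps [simp del]

text \<open>\<open>neumann\<close> grows by multiplication on the right, while the left inverse law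
  needs the next term produced from the left. The two recursions commute because they act on
  opposite sides, and at the first step both give the same single coefficient of g.\<close>

lemma neumann_Suc_left:
  assumes "k < n" "m < n"
  shows "neumann (Suc i) k m t = left_star n g (\<lambda>j. neumann i j m) k (- s k + t) / of_int (M k)"
  using assms
proof (induction i arbitrary: k m t)
  case 0
  have "right_star n g (neumann 0 k) m (t - s m) =
      (\<Sum>j<n. if k = j then of_int (g m j (s m - t + s k)) / of_int (M k) else 0)"
    unfolding right_star_def
  proof (intro sum.cong refl)
    fix j assume "j \<in> {..<n}"
    \<comment> \<open>Term 0 is supported at one point, so solving for u picks out one coefficient
      of g.\<close>
    have *: "t - s m + u = s k \<longleftrightarrow> u = s m - t + s k" for u
      by (rule diff_add_eq_iff)
    have "(\<Sum>u\<in>supp (g m j). of_int (g m j u) * neumann 0 k j (t - s m + u)) =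
       (\<Sum>u\<in>supp (g m j). if u = s m - t + s k then (if k = j then of_int (g m j u) / of_int (M k) else 0) else 0)"
      by (rule sum.cong) (auto simp: * neumann.simps(1))
    also have "\<dots> = (if k = j then of_int (g m j (s m - t + s k)) / of_int (M k) else 0)"
      using 0 \<open>j \<in> _\<close> finite_supp(2)[of m j] by (subst sum.delta) (auto simp: supp_def)
    finally show "(\<Sum>u\<in>supp (g m j). of_int (g m j u) * neumann 0 k j (t - s m + u)) = \<dots>" .
  qed
  also have "\<dots> = of_int (g m k (s m - t + s k)) / of_int (M k)" using 0 by simp
  finally have 1: "right_star n g (neumann 0 k) m (t - s m) = of_int (g m k (s m - t + s k)) / of_int (M k)" .
  have "left_star n g (\<lambda>j. neumann 0 j m) k (- s k + t) =
      (\<Sum>j<n. if j = m then of_int (g j k (s m - t + s k)) / of_int (M m) else 0)"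
    unfolding left_star_def
  proof (intro sum.cong refl)
    fix j assume "j \<in> {..<n}"
    have *: "u + (- s k + t) = s m \<longleftrightarrow> u = s m - t + s k" for u
      by (rule add_minus_add_eq_iff)
    have "(\<Sum>u\<in>supp (g j k). of_int (g j k u) * neumann 0 j m (u + (- s k + t))) =
       (\<Sum>u\<in>supp (g j k). if u = s m - t + s k then (if j = m then of_int (g j k u) / of_int (M m) else 0) else 0)"
      by (rule sum.cong) (auto simp: * neumann.simps(1))
    also have "\<dots> = (if j = m then of_int (g j k (s m - t + s k)) / of_int (M m) else 0)"
      using 0 \<open>j \<in> _\<close> finite_supp(2)[of j k] by (subst sum.delta) (auto simp: supp_def)
    finally show "(\<Sum>u\<in>supp (g j k). of_int (g j k u) * neumann 0 j m (u + (- s k + t))) = \<dots>" .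
  qed
  also have "\<dots> = of_int (g m k (s m - t + s k)) / of_int (M m)" using 0 by simp
  finally show ?case using 1 by (simp add: neumann.simps(2) mult.commute)
next
  case (Suc i)
  let ?X = "neumann i"
  have "neumann (Suc (Suc i)) k m t = (\<Sum>j<n. \<Sum>u\<in>supp (g m j). of_int (g m j u) *
      (left_star n g (\<lambda>i. ?X i j) k (- s k + (t - s m + u)) / of_int (M k))) / of_int (M m)"
    unfolding neumann.simps(2)[of "Suc i"] right_star_def
    by (intro arg_cong[where f = "\<lambda>x. x / _"] sum.cong refl) (simp add: Suc)
  also have "\<dots> = (\<Sum>j<n. \<Sum>u\<in>supp (g m j). \<Sum>i<n. \<Sum>v\<in>supp (g i k).
       of_int (g m j u) * of_int (g i k v) * ?X i j (v + (- s k + t) - s m + u)) / of_int (M k) / of_int (M m)"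
    unfolding left_star_def sum_distrib_left sum_divide_distrib group_add_reassoc
    by (intro sum.cong refl) simp
  also have "(\<Sum>j<n. \<Sum>u\<in>supp (g m j). \<Sum>i<n. \<Sum>v\<in>supp (g i k).
       of_int (g m j u) * of_int (g i k v) * ?X i j (v + (- s k + t) - s m + u)) =
      (\<Sum>i<n. \<Sum>v\<in>supp (g i k). \<Sum>j<n. \<Sum>u\<in>supp (g m j).
       of_int (g m j u) * of_int (g i k v) * ?X i j (v + (- s k + t) - s m + u))"
    by (rule sum_swap4)
  also have "\<dots> / of_int (M k) / of_int (M m) = left_star n g (\<lambda>j. neumann (Suc i) j m) k (- s k + t) / of_int (M k)"
    unfolding left_star_def neumann.simps(2) right_star_def sum_distrib_left sum_divide_distrib
    by (intro sum.cong refl) (simp add: mult_ac)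
  finally show ?case .
qed

lemma abs_neumann_Suc_le:
  "\<bar>neumann (Suc i) k m t\<bar> \<le>
    (\<Sum>j<n. \<Sum>u\<in>supp (g m j). \<bar>real_of_int (g m j u)\<bar> * \<bar>neumann i k j (t - s m + u)\<bar>) / \<bar>real_of_int (M m)\<bar>"
  unfolding neumann.simps(2) right_star_def abs_divide
  by (intro divide_right_mono order.trans[OF sum_abs] sum_mono) (auto simp: abs_mult)

text \<open>The norm in question sums over the rows k of a fixed column m. The next term combines
  the columns j with weights |g(m,j)_u| / |M_m|, whose total is at most \<open>\<rho>\<close> by row
  lopsidedness.\<close>

lemma neumann_bound:
  assumes \<rho>: "0 \<le> \<rho>" "\<And>m. m < n \<Longrightarrow> (\<Sum>j<n. \<Sum>u\<in>supp (g m j). \<bar>real_of_int (g m j u)\<bar>) \<le> \<rho> * \<bar>real_of_int (M m)\<bar>"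
    and "m < n"
  shows "(\<forall>k<n. (\<lambda>t. \<bar>neumann i k m t\<bar>) summable_on UNIV) \<and>
    (\<Sum>k<n. \<Sum>\<^sub>\<infinity>t. \<bar>neumann i k m t\<bar>) \<le> \<rho> ^ i"
  using \<open>m < n\<close>
proof (induction i arbitrary: m)
  case 0
  have hs: "((\<lambda>t. \<bar>neumann 0 k m t\<bar>) has_sum (if k = m then 1 / \<bar>real_of_int (M k)\<bar> else 0)) UNIV" for k
    by (rule has_sum_finite_neutralI[of "{s k}"]) (auto simp: neumann.simps(1))
  have "1 \<le> \<bar>real_of_int (M m)\<bar>" using M_pos[OF 0] by linarith
  then have "(\<Sum>k<n. \<Sum>\<^sub>\<infinity>t. \<bar>neumann 0 k m t\<bar>) \<le> 1"
    using 0 by (simp add: infsumI[OF hs])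
  then show ?case using hs by (auto simp: summable_on_def)
next
  case (Suc i)
  define N where "N k j = (\<Sum>\<^sub>\<infinity>t. \<bar>neumann i k j t\<bar>)" for k j
  have hs: "((\<lambda>t. (\<Sum>j<n. \<Sum>u\<in>supp (g m j). \<bar>real_of_int (g m j u)\<bar> * \<bar>neumann i k j (t - s m + u)\<bar>) * inverse \<bar>real_of_int (M m)\<bar>)
      has_sum (\<Sum>j<n. \<Sum>u\<in>supp (g m j). \<bar>real_of_int (g m j u)\<bar> * N k j) * inverse \<bar>real_of_int (M m)\<bar>) UNIV"
    if "k < n" for k
  proof (intro has_sum_cmult_left has_sum_sum finite_supp has_sum_cmult_right)
    fix j u assume "j \<in> {..<n}"
    then have "((\<lambda>t. \<bar>neumann i k j t\<bar>) has_sum N k j) UNIV"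
      using Suc.IH[of j] that by (simp add: N_def)
    then show "((\<lambda>t. \<bar>neumann i k j (t - s m + u)\<bar>) has_sum N k j) UNIV"
      using has_sum_translate_right[of "\<lambda>t. \<bar>neumann i k j t\<bar>" "- s m + u"]
      by (simp add: diff_conv_add_uminus add.assoc del: add_uminus_conv_diff)
  qed (use Suc.prems in auto)
  have sm: "(\<lambda>t. \<bar>neumann (Suc i) k m t\<bar>) summable_on UNIV" if "k < n" for k
    by (rule summable_on_comparison_test[OF has_sum_imp_summable[OF hs[OF that]]])
       (use abs_neumann_Suc_le[of i k m] in \<open>auto simp: divide_inverse\<close>)
  have le: "(\<Sum>\<^sub>\<infinity>t. \<bar>neumann (Suc i) k m t\<bar>) \<le>
      (\<Sum>j<n. \<Sum>u\<in>supp (g m j). \<bar>real_of_int (g m j u)\<bar> * N k j) * inverse \<bar>real_of_int (M m)\<bar>" if "k < n" for k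
    by (rule has_sum_mono[OF has_sum_infsum[OF sm[OF that]] hs[OF that]])
       (use abs_neumann_Suc_le[of i k m] in \<open>auto simp: divide_inverse\<close>)
  have "(\<Sum>k<n. \<Sum>\<^sub>\<infinity>t. \<bar>neumann (Suc i) k m t\<bar>) \<le>
      (\<Sum>k<n. (\<Sum>j<n. \<Sum>u\<in>supp (g m j). \<bar>real_of_int (g m j u)\<bar> * N k j) * inverse \<bar>real_of_int (M m)\<bar>)"
    by (intro sum_mono le) auto
  also have "\<dots> = (\<Sum>k<n. \<Sum>j<n. \<Sum>u\<in>supp (g m j). \<bar>real_of_int (g m j u)\<bar> * N k j) * inverse \<bar>real_of_int (M m)\<bar>"
    by (simp add: sum_distrib_right)
  also have "(\<Sum>k<n. \<Sum>j<n. \<Sum>u\<in>supp (g m j). \<bar>real_of_int (g m j u)\<bar> * N k j) =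
      (\<Sum>j<n. (\<Sum>u\<in>supp (g m j). \<bar>real_of_int (g m j u)\<bar>) * (\<Sum>k<n. N k j))"
    by (subst sum.swap) (simp add: sum_distrib_left sum_distrib_right)
  also have "\<dots> \<le> (\<Sum>j<n. (\<Sum>u\<in>supp (g m j). \<bar>real_of_int (g m j u)\<bar>) * \<rho> ^ i)"
    using Suc.IH by (intro sum_mono mult_left_mono) (auto simp: N_def intro: sum_nonneg)
  also have "\<dots> = (\<Sum>j<n. \<Sum>u\<in>supp (g m j). \<bar>real_of_int (g m j u)\<bar>) * \<rho> ^ i"
    by (simp add: sum_distrib_right)
  also have "\<dots> \<le> \<rho> * \<bar>real_of_int (M m)\<bar> * \<rho> ^ i"
    using \<rho> Suc.prems by (intro mult_right_mono) auto
  finally have "(\<Sum>k<n. \<Sum>\<^sub>\<infinity>t. \<bar>neumann (Suc i) k m t\<bar>) \<le> \<rho> * \<bar>real_of_int (M m)\<bar> * \<rho> ^ i * inverse \<bar>real_of_int (M m)\<bar>"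
    by (simp add: mult_right_mono)
  also have "\<dots> = \<rho> ^ Suc i" using M_pos[OF Suc.prems] by simp
  finally show ?case using sm by simp
qed

section \<open>The two-sided inverse as the sum of the Neumann series\<close>

definition star_inverse :: "nat \<Rightarrow> nat \<Rightarrow> 'g \<Rightarrow> real" where
  "star_inverse k m t = (\<Sum>i. neumann i k m t)"

text \<open>The geometric bound makes the double family over (i, t) absolutely summable. Exchanging
  the order of summation gives convergence in i at every t and summability of the limit in
  t.\<close>

lemma neumann_sums_l1:
  assumes "k < n" "m < n"
  shows "(\<lambda>i. neumann i k m t) sums star_inverse k m t" and "l1 (star_inverse k m)"
proof -
  obtain \<rho> where \<rho>: "0 \<le> \<rho>" "\<rho> < 1"
    "\<And>m. m < n \<Longrightarrow> (\<Sum>j<n. \<Sum>u\<in>supp (g m j). \<bar>real_of_int (g m j u)\<bar>) \<le> \<rho> * \<bar>real_of_int (M m)\<bar>"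
    using contraction_factor by blast
  have sm: "(\<lambda>t. \<bar>neumann i k m t\<bar>) summable_on UNIV" for i
    using neumann_bound[OF \<rho>(1,3) \<open>m < n\<close>] assms by auto
  have le: "(\<Sum>\<^sub>\<infinity>t. \<bar>neumann i k m t\<bar>) \<le> \<rho> ^ i" for i
  proof -
    have "(\<Sum>\<^sub>\<infinity>t. \<bar>neumann i k m t\<bar>) \<le> (\<Sum>k<n. \<Sum>\<^sub>\<infinity>t. \<bar>neumann i k m t\<bar>)"
      using assms by (intro member_le_sum infsum_nonneg) auto
    then show ?thesis using neumann_bound[OF \<rho>(1,3) \<open>m < n\<close>, of i] by linarith
  qed
  have "(\<lambda>i. \<rho> ^ i) summable_on UNIV"
    using \<rho> by (intro norm_summable_imp_summable_on) (auto simp: power_abs summable_geometric)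
  then have "(\<lambda>i. \<Sum>\<^sub>\<infinity>t. \<bar>neumann i k m t\<bar>) summable_on UNIV"
    by (rule summable_on_comparison_test) (auto intro: le infsum_nonneg)
  then have swap: "(\<lambda>(i, t). \<bar>neumann i k m t\<bar>) summable_on UNIV \<times> UNIV"
    using sm by (intro summable_on_SigmaI[where g = "\<lambda>i. \<Sum>\<^sub>\<infinity>t. \<bar>neumann i k m t\<bar>"]) auto
  have prod: "(\<lambda>(t, i). \<bar>neumann i k m t\<bar>) summable_on UNIV \<times> UNIV"
    using summable_on_swap[THEN iffD1, OF swap] by simp
  have sm_i: "(\<lambda>i. \<bar>neumann i k m t\<bar>) summable_on UNIV" for t
    using summable_on_SigmaD1[OF prod] by auto
  have norm: "summable (\<lambda>i. norm (neumann i k m t))" for t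
    using summable_on_imp_summable[OF sm_i] by simp
  show "(\<lambda>i. neumann i k m t) sums star_inverse k m t" for t
    unfolding star_inverse_def using summable_norm_cancel[OF norm] by (rule summable_sums)
  have "(\<lambda>t. \<Sum>\<^sub>\<infinity>i. \<bar>neumann i k m t\<bar>) summable_on UNIV"
    using summable_on_Sigma_banach[OF prod] by simp
  moreover have "\<bar>star_inverse k m t\<bar> \<le> (\<Sum>\<^sub>\<infinity>i. \<bar>neumann i k m t\<bar>)" for t
  proof -
    have "\<bar>star_inverse k m t\<bar> \<le> (\<Sum>i. \<bar>neumann i k m t\<bar>)"
      unfolding star_inverse_def using summable_norm[OF norm] by simp
    also have "\<dots> = (\<Sum>\<^sub>\<infinity>i. \<bar>neumann i k m t\<bar>)"
      using has_sum_imp_sums[OF has_sum_infsum[OF sm_i]] by (simp add: sums_iff)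
    finally show ?thesis .
  qed
  ultimately show "l1 (star_inverse k m)"
    unfolding l1_def by (rule summable_on_comparison_test) auto
qed

text \<open>Telescoping: the remainder part applied to one term of the series equals the diagonal
  part applied to the next. Only the diagonal part of term 0 survives, and this is the
  identity.\<close>

lemma right_star_star_inverse:
  assumes "k < n" "m < n"
  shows "right_star n f (star_inverse k) m t = idm k m t"
proof -
  let ?a = "\<lambda>i. of_int (M m) * neumann i k m (t + s m)"
  have "?a sums (of_int (M m) * star_inverse k m (t + s m))"
    by (intro sums_mult neumann_sums_l1 assms)
  moreover have "(\<lambda>i. right_star n g (neumann i k) m t) sums right_star n g (star_inverse k) m t"
    unfolding right_star_def by (intro sums_sum sums_mult neumann_sums_l1 assms) auto
  moreover have "right_star n g (neumann i k) m t = ?a (Suc i)" for i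
    using M_pos[OF assms(2)] by (simp add: neumann.simps(2))
  ultimately have "(\<lambda>i. ?a i - ?a (Suc i)) sums right_star n f (star_inverse k) m t" "?a \<longlonglongrightarrow> 0"
    using assms by (auto simp: right_star_f intro!: sums_diff summable_LIMSEQ_zero dest: sums_summable simp del: of_int_mult)
  then have "right_star n f (star_inverse k) m t = ?a 0"
    using sums_unique2 telescope_sums'[of ?a 0] by force
  then show ?thesis
    using M_pos[OF assms(2)] add_right_cancel[of t "s m" 0] by (auto simp: neumann.simps(1) idm_def)
qed

text \<open>The same telescoping, driven by the left recursion
  \<open>neumann_Suc_left\<close>.\<close>

lemma left_star_star_inverse:
  assumes "k < n" "m < n"
  shows "left_star n f (\<lambda>j. star_inverse j m) k t = idm k m t"
proof -
  let ?a = "\<lambda>i. of_int (M k) * neumann i k m (s k + t)"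
  have "?a sums (of_int (M k) * star_inverse k m (s k + t))"
    by (intro sums_mult neumann_sums_l1 assms)
  moreover have "(\<lambda>i. left_star n g (\<lambda>j. neumann i j m) k t) sums left_star n g (\<lambda>j. star_inverse j m) k t"
    unfolding left_star_def by (intro sums_sum sums_mult neumann_sums_l1 assms) auto
  moreover have "left_star n g (\<lambda>j. neumann i j m) k t = ?a (Suc i)" for i
    using M_pos[OF assms(1)] by (simp add: neumann_Suc_left assms add.assoc[symmetric])
  ultimately have "(\<lambda>i. ?a i - ?a (Suc i)) sums left_star n f (\<lambda>j. star_inverse j m) k t" "?a \<longlonglongrightarrow> 0"
    using assms by (auto simp: left_star_f intro!: sums_diff summable_LIMSEQ_zero dest: sums_summable simp del: of_int_mult)
  then have "left_star n f (\<lambda>j. star_inverse j m) k t = ?a 0"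
    using sums_unique2 telescope_sums'[of ?a 0] by force
  then show ?thesis
    using M_pos[OF assms(1)] add_left_cancel[of "s k" t 0] by (auto simp: neumann.simps(1) idm_def)
qed

abbreviation B :: "nat \<Rightarrow> nat \<Rightarrow> 'g \<Rightarrow> real" where
  "B \<equiv> finv n f"

text \<open>\<open>finv\<close> is a choice among inverses, so \<open>star_inverse\<close> serves as
  the witness of existence; afterwards only the inverse laws and summability are used.\<close>

lemma is_l1_inverse_finv: "is_l1_inverse n (star_mat f) B"
proof -
  have "l1 (star_mat f k m)" if "k < n" "m < n" for k m
  proof -
    have "finite (uminus ` supp (f m k))" using finite_supp that by simp
    then have "((\<lambda>t. \<bar>star_mat f k m t\<bar>) has_sum (\<Sum>t\<in>uminus ` supp (f m k). \<bar>star_mat f k m t\<bar>)) UNIV"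
      by (rule has_sum_finite_neutralI) (auto simp: star_mat_def supp_def image_iff intro: minus_minus[symmetric])
    then show ?thesis unfolding l1_def by (rule has_sum_imp_summable)
  qed
  then have "is_l1_inverse n (star_mat f) star_inverse"
    unfolding is_l1_inverse_def
    by (auto simp: fun_eq_iff matmul_star_left matmul_star_right finite_supp neumann_sums_l1
        right_star_star_inverse left_star_star_inverse)
  then show ?thesis unfolding finv_def by (rule someI[where P = "is_l1_inverse n (star_mat f)"])
qed

lemma l1_finv: "k < n \<Longrightarrow> m < n \<Longrightarrow> l1 (B k m)"
  using is_l1_inverse_finv unfolding is_l1_inverse_def by blast

lemma right_star_finv: "k < n \<Longrightarrow> m < n \<Longrightarrow> right_star n f (B k) m t = idm k m t"
  using is_l1_inverse_finv matmul_star_right[of n f m B k t] finite_supp unfolding is_l1_inverse_def by metis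

lemma left_star_finv: "k < n \<Longrightarrow> m < n \<Longrightarrow> left_star n f (\<lambda>j. B j m) k t = idm k m t"
  using is_l1_inverse_finv matmul_star_left[of n f k B m t] finite_supp unfolding is_l1_inverse_def by metis

end

section \<open>Action on bounded configurations\<close>

lemma has_sum_translate_left:
  fixes h :: "'g::group_add \<Rightarrow> 'b::topological_comm_monoid_add"
  shows "((\<lambda>t. h (c + t)) has_sum a) UNIV \<longleftrightarrow> (h has_sum a) UNIV"
  by (rule has_sum_reindex_bij_witness[of _ "\<lambda>t. - c + t" "\<lambda>t. c + t"]) (auto simp flip: add.assoc)

lemma has_sum_conv:
  assumes "\<And>t. \<bar>x t\<bar> \<le> C" "l1 b"
  shows "((\<lambda>s. x (t - s) * b s) has_sum conv x b t) UNIV"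
    and "\<bar>conv x b t\<bar> \<le> C * (\<Sum>\<^sub>\<infinity>s. \<bar>b s\<bar>)"
proof -
  have sm: "(\<lambda>s. C * \<bar>b s\<bar>) summable_on UNIV"
    using assms(2) unfolding l1_def by (rule summable_on_cmult_right)
  have le: "norm (x (t - s) * b s) \<le> C * \<bar>b s\<bar>" for s
    using assms(1) by (simp add: abs_mult mult_right_mono)
  have abs: "(\<lambda>s. norm (x (t - s) * b s)) summable_on UNIV"
    using sm by (rule summable_on_comparison_test) (use le in auto)
  show "((\<lambda>s. x (t - s) * b s) has_sum conv x b t) UNIV"
    unfolding conv_def by (rule has_sum_infsum[OF abs_summable_summable[OF abs]])
  have "norm (conv x b t) \<le> (\<Sum>\<^sub>\<infinity>s. norm (x (t - s) * b s))"
    unfolding conv_def using abs by (rule norm_infsum_bound)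
  also have "\<dots> \<le> (\<Sum>\<^sub>\<infinity>s. C * \<bar>b s\<bar>)"
    using abs sm le by (intro infsum_mono) auto
  also have "\<dots> = C * (\<Sum>\<^sub>\<infinity>s. \<bar>b s\<bar>)"
    by (rule infsum_cmult_right')
  finally show "\<bar>conv x b t\<bar> \<le> C * (\<Sum>\<^sub>\<infinity>s. \<bar>b s\<bar>)" by simp
qed

lemma right_star_of_int:
  "right_star n f (\<lambda>k t. of_int (z k t) :: real) m t = of_int (right_star n f z m t)"
  by (simp add: right_star_def)

lemma right_star_diff:
  "right_star n f (\<lambda>k t. x k t - y k t) m t = right_star n f x m t - right_star n f y m t"
  by (simp add: right_star_def right_diff_distrib sum_subtractf)

lemma right_star_cong:
  assumes "\<And>k t. k < n \<Longrightarrow> x k t = y k t"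
  shows "right_star n f x m t = right_star n f y m t"
  using assms by (simp add: right_star_def)

context lopsided
begin

text \<open>The real lift x F^-1 of a bounded row vector x; \<open>phi\<close> is its fractional
  part.\<close>

definition act :: "(nat \<Rightarrow> 'g \<Rightarrow> real) \<Rightarrow> nat \<Rightarrow> 'g \<Rightarrow> real" where
  "act x m t = (\<Sum>k<n. conv (x k) (B k m) t)"

text \<open>Associativity (x F^-1) F = x (F^-1 F), valid because F has finite supports and the
  remaining sum converges absolutely for bounded x.\<close>

lemma right_star_act:
  assumes x: "\<And>k t. \<bar>x k t\<bar> \<le> C" and m: "m < n"
  shows "right_star n f (act x) m t = x m t"
proof -
  have "(\<Sum>j<n. \<Sum>u\<in>supp (f m j). of_int (f m j u) * conv (x k) (B k j) (t + u)) = (if k = m then x m t else 0)"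
    if k: "k < n" for k
  proof (rule has_sum_unique)
    show "((\<lambda>s. \<Sum>j<n. \<Sum>u\<in>supp (f m j). of_int (f m j u) * (x k (t - s) * B k j (s + u))) has_sum
        (\<Sum>j<n. \<Sum>u\<in>supp (f m j). of_int (f m j u) * conv (x k) (B k j) (t + u))) UNIV"
    proof (intro has_sum_sum has_sum_cmult_right)
      fix j u assume "j \<in> {..<n}"
      \<comment> \<open>Translating the summation variable by u gives all terms the common factor
        \<open>x k (t - s)\<close>.\<close>
      then have "((\<lambda>s. x k (t + u - (s + u)) * B k j (s + u)) has_sum conv (x k) (B k j) (t + u)) UNIV"
        using has_sum_conv(1)[OF x l1_finv[OF k]] by (subst has_sum_translate_right) auto
      moreover have "t + u - (s + u) = t - s" for s
        by (simp add: diff_conv_add_uminus minus_add add.assoc del: add_uminus_conv_diff)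
      ultimately show "((\<lambda>s. x k (t - s) * B k j (s + u)) has_sum conv (x k) (B k j) (t + u)) UNIV"
        by simp
    qed (use finite_supp m in auto)
    have e: "(\<Sum>j<n. \<Sum>u\<in>supp (f m j). of_int (f m j u) * (x k (t - s) * B k j (s + u))) = x k (t - s) * idm k m s" for s
      using right_star_finv[OF k m, of s, symmetric] by (simp add: right_star_def sum_distrib_left mult.left_commute)
    show "((\<lambda>s. \<Sum>j<n. \<Sum>u\<in>supp (f m j). of_int (f m j u) * (x k (t - s) * B k j (s + u))) has_sum
        (if k = m then x m t else 0)) UNIV"
      unfolding e by (intro has_sum_finite_neutralI[of "{0}"]) (auto simp: idm_def)
  qed
  note eq = this
  have "right_star n f (act x) m t =
     (\<Sum>k<n. \<Sum>j<n. \<Sum>u\<in>supp (f m j). of_int (f m j u) * conv (x k) (B k j) (t + u))"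
    unfolding right_star_def act_def sum_distrib_left
    by (rule trans[OF sum.cong[OF refl sum.swap] sum.swap])
  also have "\<dots> = x m t" using m by (simp add: eq)
  finally show ?thesis .
qed

text \<open>Associativity on the other side, resting on the left inverse law. With
  \<open>right_star_act\<close> it shows that multiplication by F and \<open>act\<close> are
  mutually inverse on bounded row vectors.\<close>

lemma act_right_star:
  assumes x: "\<And>k t. \<bar>x k t\<bar> \<le> C" and m: "m < n"
  shows "act (right_star n f x) m t = x m t"
proof -
  define c where "c k j u = (\<Sum>\<^sub>\<infinity>s. x j (t - s + u) * B k m s)" for k j u
  have c: "((\<lambda>s. x j (t - s + u) * B k m s) has_sum c k j u) UNIV" if "k < n" for k j u
  proof -
    have "(\<lambda>s. x j (t - s + u) * B k m s) summable_on UNIV"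
    proof (rule abs_summable_summable, rule summable_on_comparison_test)
      show "(\<lambda>s. C * \<bar>B k m s\<bar>) summable_on UNIV"
        using l1_finv[OF that m] unfolding l1_def by (rule summable_on_cmult_right)
    qed (use x in \<open>auto simp: abs_mult mult_right_mono\<close>)
    then show ?thesis unfolding c_def by (rule has_sum_infsum)
  qed
  have 1: "conv (right_star n f x k) (B k m) t = (\<Sum>j<n. \<Sum>u\<in>supp (f k j). of_int (f k j u) * c k j u)" if "k < n" for k
  proof -
    have "((\<lambda>s. \<Sum>j<n. \<Sum>u\<in>supp (f k j). of_int (f k j u) * (x j (t - s + u) * B k m s)) has_sum
        (\<Sum>j<n. \<Sum>u\<in>supp (f k j). of_int (f k j u) * c k j u)) UNIV"
      by (intro has_sum_sum has_sum_cmult_right c) (use finite_supp that in auto)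
    then show ?thesis
      by (simp add: conv_def right_star_def sum_distrib_right mult.assoc infsumI)
  qed
  have 2: "(\<Sum>k<n. \<Sum>u\<in>supp (f k j). of_int (f k j u) * c k j u) = (if j = m then x m t else 0)" if j: "j < n" for j
  proof (rule has_sum_unique)
    show "((\<lambda>s. \<Sum>k<n. \<Sum>u\<in>supp (f k j). of_int (f k j u) * (x j (t - s) * B k m (u + s))) has_sum
        (\<Sum>k<n. \<Sum>u\<in>supp (f k j). of_int (f k j u) * c k j u)) UNIV"
    proof (intro has_sum_sum has_sum_cmult_right)
      fix k u assume "k \<in> {..<n}"
      then have "((\<lambda>s. x j (t - (u + s) + u) * B k m (u + s)) has_sum c k j u) UNIV"
        using c by (subst has_sum_translate_left) auto
      moreover have "t - (u + s) + u = t - s" for s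
        by (simp add: diff_conv_add_uminus minus_add add.assoc del: add_uminus_conv_diff)
      ultimately show "((\<lambda>s. x j (t - s) * B k m (u + s)) has_sum c k j u) UNIV"
        by simp
    qed (use finite_supp j in auto)
    have e: "(\<Sum>k<n. \<Sum>u\<in>supp (f k j). of_int (f k j u) * (x j (t - s) * B k m (u + s))) = x j (t - s) * idm j m s" for s
      using left_star_finv[OF j m, of s, symmetric] by (simp add: left_star_def sum_distrib_left mult.left_commute)
    show "((\<lambda>s. \<Sum>k<n. \<Sum>u\<in>supp (f k j). of_int (f k j u) * (x j (t - s) * B k m (u + s))) has_sum
        (if j = m then x m t else 0)) UNIV"
      unfolding e by (intro has_sum_finite_neutralI[of "{0}"]) (auto simp: idm_def)
  qed
  have "act (right_star n f x) m t = (\<Sum>k<n. \<Sum>j<n. \<Sum>u\<in>supp (f k j). of_int (f k j u) * c k j u)"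
    by (simp add: act_def 1)
  also have "\<dots> = (\<Sum>j<n. \<Sum>k<n. \<Sum>u\<in>supp (f k j). of_int (f k j u) * c k j u)"
    by (rule sum.swap)
  also have "\<dots> = x m t" using m by (simp add: 2)
  finally show ?thesis .
qed

lemma act_bounded:
  assumes "\<And>k t. \<bar>x k t\<bar> \<le> C"
  shows "\<exists>D. \<forall>m<n. \<forall>t. \<bar>act x m t\<bar> \<le> D"
proof (intro exI allI impI)
  fix m t assume "m < n"
  have "0 \<le> C" using assms[of 0 0] by linarith
  have "\<bar>act x m t\<bar> \<le> (\<Sum>k<n. C * (\<Sum>\<^sub>\<infinity>s. \<bar>B k m s\<bar>))"
    unfolding act_def using \<open>m < n\<close> assms
    by (intro order.trans[OF sum_abs] sum_mono has_sum_conv(2) l1_finv) auto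
  also have "\<dots> \<le> (\<Sum>m<n. \<Sum>k<n. C * (\<Sum>\<^sub>\<infinity>s. \<bar>B k m s\<bar>))"
    using \<open>m < n\<close> \<open>0 \<le> C\<close> by (intro member_le_sum[where f = "\<lambda>m. \<Sum>k<n. C * (\<Sum>\<^sub>\<infinity>s. \<bar>B k m s\<bar>)"] sum_nonneg mult_nonneg_nonneg infsum_nonneg) auto
  finally show "\<bar>act x m t\<bar> \<le> (\<Sum>m<n. \<Sum>k<n. C * (\<Sum>\<^sub>\<infinity>s. \<bar>B k m s\<bar>))" .
qed

lemma act_diff:
  assumes "\<And>k t. \<bar>x k t\<bar> \<le> C" "\<And>k t. \<bar>y k t\<bar> \<le> D" "m < n"
  shows "act (\<lambda>k t. x k t - y k t) m t = act x m t - act y m t"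
  unfolding act_def sum_subtractf[symmetric]
proof (rule sum.cong)
  fix k assume "k \<in> {..<n}"
  then have "l1 (B k m)" using l1_finv assms by simp
  then have "((\<lambda>s. x k (t - s) * B k m s + - (y k (t - s) * B k m s)) has_sum (conv (x k) (B k m) t + - conv (y k) (B k m) t)) UNIV"
    by (intro has_sum_add has_sum_uminusI has_sum_conv(1)[OF assms(1)] has_sum_conv(1)[OF assms(2)])
  then show "conv (\<lambda>t. x k t - y k t) (B k m) t = conv (x k) (B k m) t - conv (y k) (B k m) t"
    unfolding conv_def[of "\<lambda>t. x k t - y k t"] by (simp add: infsumI left_diff_distrib)
qed simp

abbreviation emb :: "('g \<Rightarrow> nat \<Rightarrow> int) \<Rightarrow> nat \<Rightarrow> 'g \<Rightarrow> real" where
  "emb y \<equiv> \<lambda>k t. real_of_int (y t k)"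

lemma phi_eq: "phi n f y m t = (if m < n then frac (act (emb y) m t) else 0)"
  unfolding phi_def act_def conv_def by simp

lemma SfG_bounds:
  assumes "y \<in> SfG n M" "k < n"
  shows "0 \<le> y t k" "y t k < \<bar>M k\<bar>"
  using assms by (auto simp: SfG_def Sf_def Pi_iff)

lemma SfG_eq_0: "y \<in> SfG n M \<Longrightarrow> n \<le> k \<Longrightarrow> y t k = 0"
  by (auto simp: SfG_def Sf_def Pi_iff)

text \<open>A sum instead of a maximum, so that the bound also makes sense for n = 0.\<close>

definition Mmax :: int where
  "Mmax = (\<Sum>k<n. \<bar>M k\<bar>)"

lemma M_le_Mmax: "k < n \<Longrightarrow> \<bar>M k\<bar> \<le> Mmax"
  unfolding Mmax_def by (rule member_le_sum) auto

lemma emb_bounded: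
  assumes "y \<in> SfG n M"
  shows "\<bar>emb y k t\<bar> \<le> real_of_int Mmax"
proof (cases "k < n")
  case True
  then show ?thesis using SfG_bounds[OF assms True, of t] M_le_Mmax[OF True] by linarith
next
  case False
  then show ?thesis using SfG_eq_0[OF assms, of k t] by (simp add: Mmax_def sum_nonneg)
qed

text \<open>The representative of the image is y F^-1 minus an integer vector; multiplying by F
  gives y minus another integer vector.\<close>

lemma phi_in_Xf:
  assumes "y \<in> SfG n M"
  shows "phi n f y \<in> Xf n f"
proof -
  have "(\<Sum>k<n. \<Sum>s\<in>{s. f m k (- s) \<noteq> 0}. phi n f y k (t - s) * real_of_int (f m k (- s))) \<in> \<int>" if "m < n" for m t
  proof -
    have "(\<Sum>s\<in>{s. f m k (- s) \<noteq> 0}. phi n f y k (t - s) * real_of_int (f m k (- s))) =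
        (\<Sum>u\<in>supp (f m k). real_of_int (f m k u) * phi n f y k (t + u))" for k
      by (rule sum.reindex_bij_witness[of _ uminus uminus]) (auto simp: supp_def)
    then have "(\<Sum>k<n. \<Sum>s\<in>{s. f m k (- s) \<noteq> 0}. phi n f y k (t - s) * real_of_int (f m k (- s))) =
        right_star n f (phi n f y) m t"
      by (simp add: right_star_def)
    also have "\<dots> = right_star n f (\<lambda>k t. act (emb y) k t - of_int \<lfloor>act (emb y) k t\<rfloor>) m t"
      by (rule right_star_cong) (simp add: phi_eq frac_def)
    also have "\<dots> = of_int (y t m) - of_int (right_star n f (\<lambda>k t. \<lfloor>act (emb y) k t\<rfloor>) m t)"
      using that by (simp only: right_star_diff right_star_of_int right_star_act[OF emb_bounded[OF assms]])
    finally show ?thesis by simp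
  qed
  then show ?thesis
    unfolding Xf_def by (auto simp: phi_eq frac_ge_0 frac_lt_1)
qed

lemma phi_shiftY: "phi n f (shiftY \<gamma> y) = shiftX \<gamma> (phi n f y)"
  by (simp add: fun_eq_iff phi_eq shiftX_def shiftY_def act_def conv_def diff_conv_add_uminus add.assoc
      del: add_uminus_conv_diff)

section \<open>Collisions as bounded integer directions\<close>

definition perturb :: "('g \<Rightarrow> nat \<Rightarrow> int) \<Rightarrow> (nat \<Rightarrow> 'g \<Rightarrow> int) \<Rightarrow> 'g \<Rightarrow> nat \<Rightarrow> int" where
  "perturb y z t k = (if k < n then y t k - right_star n f z k t else 0)"

text \<open>Equal images mean that the lifts y F^-1 and y' F^-1 differ by an integer vector z,
  bounded because both lifts are, and then y' = y - z F. Conversely, subtracting z F from y moves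
  the lift by -z and keeps all fractional parts.\<close>

lemma phi_collision_iff:
  assumes y: "y \<in> SfG n M"
  shows "(\<exists>y'\<in>SfG n M. y' \<noteq> y \<and> phi n f y' = phi n f y) \<longleftrightarrow>
    (\<exists>z C. (\<forall>k t. \<bar>z k t\<bar> \<le> int C) \<and> (\<exists>k<n. \<exists>t. z k t \<noteq> 0) \<and> perturb y z \<in> SfG n M)"
proof
  assume "\<exists>y'\<in>SfG n M. y' \<noteq> y \<and> phi n f y' = phi n f y"
  then obtain y' where y': "y' \<in> SfG n M" "y' \<noteq> y" "phi n f y' = phi n f y" by blast
  \<comment> \<open>Equal fractional parts turn the difference of floors into the difference of the
    lifts. The value 0 for k >= n lets one bound serve all indices.\<close>
  define z where "z k t = (if k < n then \<lfloor>act (emb y) k t\<rfloor> - \<lfloor>act (emb y') k t\<rfloor> else 0)" for k t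
  have z: "real_of_int (z k t) = act (emb y) k t - act (emb y') k t" if "k < n" for k t
  proof -
    have "frac (act (emb y') k t) = frac (act (emb y) k t)"
      using y'(3) that phi_eq[of y k t] phi_eq[of y' k t] by simp
    then show ?thesis using that by (simp add: z_def frac_def)
  qed
  obtain D where D: "\<And>k t. k < n \<Longrightarrow> \<bar>act (emb y) k t\<bar> \<le> D"
    using act_bounded[of "emb y", OF emb_bounded[OF y]] by blast
  obtain D' where D': "\<And>k t. k < n \<Longrightarrow> \<bar>act (emb y') k t\<bar> \<le> D'"
    using act_bounded[of "emb y'", OF emb_bounded[OF y'(1)]] by blast
  have "\<bar>z k t\<bar> \<le> int (nat \<lceil>D + D'\<rceil>)" for k t
  proof (cases "k < n")
    case True
    have "\<bar>real_of_int (z k t)\<bar> \<le> D + D'"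
      using z[OF True, of t] D[OF True, of t] D'[OF True, of t] by linarith
    then show ?thesis by linarith
  qed (simp add: z_def)
  moreover have rs: "right_star n f z k t = y t k - y' t k" if "k < n" for k t
  proof -
    have "real_of_int (right_star n f z k t) = right_star n f (\<lambda>k t. act (emb y) k t - act (emb y') k t) k t"
      unfolding right_star_of_int[symmetric] by (rule right_star_cong) (rule z)
    also have "\<dots> = real_of_int (y t k - y' t k)"
      using that by (simp add: right_star_diff right_star_act[OF emb_bounded[OF y]] right_star_act[OF emb_bounded[OF y'(1)]])
    finally show ?thesis by linarith
  qed
  moreover have "perturb y z = y'"
    using SfG_eq_0[OF y'(1)] by (auto simp: perturb_def rs fun_eq_iff)
  moreover have "\<exists>k<n. \<exists>t. z k t \<noteq> 0"
  proof (rule ccontr)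
    assume "\<not> ?thesis"
    then have "y t k = y' t k" if "k < n" for t k
      using rs[OF that, of t] right_star_cong[of n z "\<lambda>_ _. 0" f k t] by (auto simp: right_star_def)
    then have "y t k = y' t k" for t k
      using SfG_eq_0[OF y] SfG_eq_0[OF y'(1)] by (cases "k < n") auto
    then show False using y'(2) by (auto simp: fun_eq_iff)
  qed
  ultimately show "\<exists>z C. (\<forall>k t. \<bar>z k t\<bar> \<le> int C) \<and> (\<exists>k<n. \<exists>t. z k t \<noteq> 0) \<and> perturb y z \<in> SfG n M"
    using y'(1) by blast
next
  assume "\<exists>z C. (\<forall>k t. \<bar>z k t\<bar> \<le> int C) \<and> (\<exists>k<n. \<exists>t. z k t \<noteq> 0) \<and> perturb y z \<in> SfG n M"
  then obtain z C k0 t0 where z: "\<And>k t. \<bar>z k t\<bar> \<le> int C" "k0 < n" "z k0 t0 \<noteq> 0" "perturb y z \<in> SfG n M"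
    by blast
  let ?y = "perturb y z" and ?z = "\<lambda>k t. real_of_int (z k t)"
  have zb: "\<bar>?z k t\<bar> \<le> real C" for k t using z(1)[of k t] by linarith
  \<comment> \<open>The two configurations differ by z F, which \<open>act\<close> sends back to
    z.\<close>
  have act_z: "act (\<lambda>k t. emb y k t - emb ?y k t) k t = z k t" if "k < n" for k t
  proof -
    have "act (\<lambda>k t. emb y k t - emb ?y k t) k t = act (right_star n f ?z) k t"
    proof -
      have "(\<lambda>t. emb y k t - emb ?y k t) = right_star n f ?z k" if "k < n" for k
        using that by (simp add: fun_eq_iff perturb_def right_star_of_int)
      then show ?thesis unfolding act_def by simp
    qed
    then show ?thesis using act_right_star[OF zb that] by simp
  qed
  have "phi n f ?y k t = phi n f y k t" for k t
  proof (cases "k < n")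
    case True
    have "act (emb y) k t = act (emb ?y) k t + of_int (z k t)"
      using act_diff[of "emb y" _ "emb ?y", OF emb_bounded[OF y] emb_bounded[OF z(4)] True, of t] act_z[OF True, of t] by simp
    then show ?thesis by (simp add: phi_eq frac_def)
  qed (simp add: phi_eq)
  \<comment> \<open>Otherwise z would be the image of the zero vector under
    \<open>act\<close>.\<close>
  moreover have "?y \<noteq> y"
  proof
    assume "?y = y"
    then have "act (\<lambda>_ _. 0) k0 t0 = z k0 t0"
      using act_z[OF z(2), of t0] by simp
    then show False using z(3) by (simp add: act_def conv_def)
  qed
  ultimately show "\<exists>y'\<in>SfG n M. y' \<noteq> y \<and> phi n f y' = phi n f y"
    using z(4) by (auto simp: fun_eq_iff)
qed

end

section \<open>Random envelopes of collision directions\<close>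

text \<open>Hermite's identity in integer form. Raising a by one shifts a window of N consecutive
  dividends, exchanging the quotient of a for that of N + a, which is larger by one.\<close>

lemma sum_add_div_nat:
  fixes N :: nat
  assumes "0 < N"
  shows "(\<Sum>v<N. (v + a) div N) = a"
proof (induction a)
  case 0
  then show ?case by simp
next
  case (Suc a)
  have "(\<Sum>v<N. (v + Suc a) div N) = (\<Sum>v<N. (Suc v + a) div N)" by simp
  also have "\<dots> = (\<Sum>v\<in>{Suc 0..<Suc N}. (v + a) div N)"
    by (simp only: lessThan_atLeast0 sum.shift_bounds_Suc_ivl)
  also have "\<dots> + (0 + a) div N = (\<Sum>v<Suc N. (v + a) div N)"
    unfolding lessThan_atLeast0 by (subst (2) sum.atLeast_Suc_lessThan) simp_all
  then have "(\<Sum>v\<in>{Suc 0..<Suc N}. (v + a) div N) + a div N = a + (N + a) div N"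
    using Suc by simp
  then have "(\<Sum>v\<in>{Suc 0..<Suc N}. (v + a) div N) = Suc a" using assms by simp
  finally show ?case .
qed

text \<open>Replacing the value at t by an independent sample of \<open>\<nu>\<close> preserves the
  product measure; Tonelli then allows integration over that sample first.\<close>

lemma nn_integral_nuG_resample:
  fixes F :: "('g::countable \<Rightarrow> nat \<Rightarrow> int) \<Rightarrow> ennreal"
  assumes F: "F \<in> borel_measurable (nuG \<nu>)"
  shows "(\<integral>\<^sup>+y. F y \<partial>nuG \<nu>) = (\<integral>\<^sup>+y. (\<integral>\<^sup>+v. F (y(t := v)) \<partial>measure_pmf \<nu>) \<partial>nuG \<nu>)"
proof -
  let ?T = "\<lambda>(v, y). y(t := v)"
  interpret ps: prob_space "nuG \<nu> :: ('g \<Rightarrow> nat \<Rightarrow> int) measure"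
    unfolding nuG_def by (intro prob_space_PiM measure_pmf.prob_space_axioms)
  interpret pair_sigma_finite "measure_pmf \<nu>" "nuG \<nu> :: ('g \<Rightarrow> nat \<Rightarrow> int) measure" ..
  have T: "?T \<in> measurable (measure_pmf \<nu> \<Otimes>\<^sub>M nuG \<nu>) (nuG \<nu>)"
    unfolding nuG_def by (auto simp: split_def intro!: measurable_fun_upd[where J = UNIV])
  have "nuG \<nu> = distr (measure_pmf \<nu> \<Otimes>\<^sub>M nuG \<nu>) (nuG \<nu>) ?T"
    unfolding nuG_def
    using distr_pair_PiM_eq_PiM[where I = UNIV and M = "\<lambda>_. measure_pmf \<nu>" and i' = t,
        OF measure_pmf.prob_space_axioms measure_pmf.prob_space_axioms] by simp
  then have "(\<integral>\<^sup>+y. F y \<partial>nuG \<nu>) = (\<integral>\<^sup>+y. F y \<partial>distr (measure_pmf \<nu> \<Otimes>\<^sub>M nuG \<nu>) (nuG \<nu>) ?T)"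
    by simp
  also have "\<dots> = (\<integral>\<^sup>+p. F (?T p) \<partial>(measure_pmf \<nu> \<Otimes>\<^sub>M nuG \<nu>))"
    by (rule nn_integral_distr) (use T F in auto)
  also have "\<dots> = (\<integral>\<^sup>+y. (\<integral>\<^sup>+v. F (?T (v, y)) \<partial>measure_pmf \<nu>) \<partial>nuG \<nu>)"
    by (rule nn_integral_snd[symmetric]) (use measurable_compose[OF T F] in simp)
  finally show ?thesis by simp
qed

lemma measurable_nuG_component: "(\<lambda>y. h (y t)) \<in> borel_measurable (nuG \<nu>)"
proof -
  have "(\<lambda>y. y t) \<in> measurable (nuG \<nu>) (measure_pmf \<nu>)"
    unfolding nuG_def by (rule measurable_component_singleton) simp
  then show ?thesis by (rule measurable_compose) simp
qed

context lopsided
begin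

text \<open>A collision direction z satisfies sgn (M m) * z m (t + s m) \<le> envelope C y i True m t for all i,
  and its negative is bounded by the envelope with False. The entry at t is computed from y t m and from
  the envelope at the strictly larger points t + (u - s j), so these two are independent.\<close>

fun envelope :: "nat \<Rightarrow> ('g \<Rightarrow> nat \<Rightarrow> int) \<Rightarrow> nat \<Rightarrow> bool \<Rightarrow> nat \<Rightarrow> 'g \<Rightarrow> nat" where
  "envelope C y 0 b m t = C"
| "envelope C y (Suc i) b m t =
    (nat (if b then y t m else \<bar>M m\<bar> - 1 - y t m) +
      (\<Sum>j<n. \<Sum>u\<in>supp (g m j). nat \<bar>g m j u\<bar> * envelope C y i (b = (0 < g m j u * M j)) j (t + (u - s j))))
    div nat \<bar>M m\<bar>"

declare envelope.simps(2) [simp del]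

text \<open>The contribution of the larger points to the numerator, separated from that of
  \<open>y t m\<close>.\<close>

definition drift :: "nat \<Rightarrow> ('g \<Rightarrow> nat \<Rightarrow> int) \<Rightarrow> nat \<Rightarrow> bool \<Rightarrow> nat \<Rightarrow> 'g \<Rightarrow> nat" where
  "drift C y i b m t =
    (\<Sum>j<n. \<Sum>u\<in>supp (g m j). nat \<bar>g m j u\<bar> * envelope C y i (b = (0 < g m j u * M j)) j (t + (u - s j)))"

lemma envelope_Suc:
  "envelope C y (Suc i) b m t = (nat (if b then y t m else \<bar>M m\<bar> - 1 - y t m) + drift C y i b m t) div nat \<bar>M m\<bar>"
  by (simp add: envelope.simps(2) drift_def)

text \<open>Reading y - z F = y' at (m, t) expresses |M_m| times the signed entry of z through y, y'
  and entries at larger points. Induction bounds the latter, and the quotient may be rounded down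
  because the entry is an integer.\<close>

lemma envelope_dominates:
  assumes y: "y \<in> SfG n M" "perturb y z \<in> SfG n M" and z: "\<And>k t. \<bar>z k t\<bar> \<le> int C"
    and "m < n"
  shows "(if b then 1 else -1) * sgn (M m) * z m (t + s m) \<le> int (envelope C y i b m t)"
  using \<open>m < n\<close>
proof (induction i arbitrary: b m t)
  case 0
  show ?case using z[of m "t + s m"] by (auto simp: sgn_if abs_if split: if_splits)
next
  case (Suc i)
  let ?\<sigma> = "\<lambda>b. if b then 1 else (-1 :: int)" and ?y' = "perturb y z"
  have "\<bar>M m\<bar> * (?\<sigma> b * sgn (M m) * z m (t + s m)) = ?\<sigma> b * (\<bar>M m\<bar> * sgn (M m) * z m (t + s m))"
    by (simp only: mult_ac)
  also have "\<bar>M m\<bar> * sgn (M m) = M m" by (simp add: sgn_if)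
  also have "?\<sigma> b * (M m * z m (t + s m)) = ?\<sigma> b * (y t m - ?y' t m) + ?\<sigma> b * right_star n g z m t"
    using Suc.prems by (simp add: perturb_def right_star_f algebra_simps)
  \<comment> \<open>The unknown y' enters only through 0 <= y' <= |M_m| - 1, so what remains depends
    on y alone.\<close>
  also have "?\<sigma> b * (y t m - ?y' t m) \<le> int (nat (if b then y t m else \<bar>M m\<bar> - 1 - y t m))"
    using SfG_bounds[OF y(1) Suc.prems, of t] SfG_bounds[OF y(2) Suc.prems, of t] by auto
  also have "?\<sigma> b * right_star n g z m t =
      (\<Sum>j<n. \<Sum>u\<in>supp (g m j). ?\<sigma> b * (g m j u * z j (t + u)))"
    by (simp add: right_star_def sum_distrib_left)
  also have "\<dots> \<le> (\<Sum>j<n. \<Sum>u\<in>supp (g m j). int (nat \<bar>g m j u\<bar> * envelope C y i (b = (0 < g m j u * M j)) j (t + (u - s j))))"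
  proof (intro sum_mono)
    fix j u assume ju: "j \<in> {..<n}" "u \<in> supp (g m j)"
    then have nz: "g m j u \<noteq> 0" "M j \<noteq> 0" using M_pos[of j] by (auto simp: supp_def)
    let ?b = "b = (0 < g m j u * M j)"
    define x where "x = z j (t + u)"
    \<comment> \<open>The sign of \<open>g m j u * M j\<close> decides whether the bound for z or
      the one for -z is needed at j; the flag \<open>?b\<close> records this.\<close>
    have "?\<sigma> b * (g m j u * x) = \<bar>g m j u\<bar> * (?\<sigma> ?b * sgn (M j) * x)"
      using nz by (cases "g m j u > 0"; cases "M j > 0"; cases b)
        (auto simp: sgn_if abs_if zero_less_mult_iff)
    also have "\<dots> \<le> \<bar>g m j u\<bar> * int (envelope C y i ?b j (t + (u - s j)))"
      using Suc.IH[of j ?b "t + (u - s j)"] ju by (intro mult_left_mono) (auto simp: x_def add.assoc)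
    finally have "?\<sigma> b * (g m j u * x) \<le> \<bar>g m j u\<bar> * int (envelope C y i ?b j (t + (u - s j)))" .
    then show "?\<sigma> b * (g m j u * z j (t + u)) \<le> int (nat \<bar>g m j u\<bar> * envelope C y i ?b j (t + (u - s j)))"
      by (simp add: x_def)
  qed
  also have "\<dots> = int (drift C y i b m t)" by (simp add: drift_def)
  finally have "\<bar>M m\<bar> * (?\<sigma> b * sgn (M m) * z m (t + s m)) \<le>
      int (nat (if b then y t m else \<bar>M m\<bar> - 1 - y t m)) + int (drift C y i b m t)" by simp
  from zdiv_mono1[OF this M_pos[OF Suc.prems]] M_pos[OF Suc.prems] show ?case
    by (simp add: envelope_Suc zdiv_int)
qed

text \<open>Right invariance, applied with \<open>- s m\<close>, moves the support of g into the
  strictly positive cone of \<open>le\<close>.\<close>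

lemma pos_shift:
  assumes "k < n" "m < n" "u \<in> supp (g k m)"
  shows "le 0 (u - s m)" "u - s m \<noteq> 0"
  using less_supp[OF assms] le_add_right_iff[of "s m" "- s m" u] by auto

text \<open>The relation \<open>le 0 (- r + t)\<close> is the left-invariant order with the same
  positive cone as \<open>le\<close>. The envelope at r reads y only at points above or equal to r
  in it, since every recursion step adds a positive element on the right.\<close>

lemma envelope_fun_upd:
  assumes "k < n" "\<not> le 0 (- r + t)"
  shows "envelope C (y(t := v)) i b k r = envelope C y i b k r"
  using assms
proof (induction i arbitrary: b k r)
  case (Suc i)
  have "r \<noteq> t" using Suc.prems le_refl[of 0] by auto
  moreover have "drift C (y(t := v)) i b k r = drift C y i b k r"
    unfolding drift_def
  proof (intro sum.cong refl arg_cong2[where f = "(*)"] Suc.IH)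
    fix j u assume ju: "j \<in> {..<n}" "u \<in> supp (g k j)"
    let ?p = "u - s j"
    show "\<not> le 0 (- (r + ?p) + t)"
    proof
      \<comment> \<open>The difference -r + t is p plus the difference from r + p to t, and adding
        the positive p on the left keeps it nonnegative.\<close>
      assume "le 0 (- (r + ?p) + t)"
      moreover have "le (0 + (- (r + ?p) + t)) (?p + (- (r + ?p) + t))"
        using pos_shift ju Suc.prems by (simp only: le_add_right_iff) simp
      moreover have "?p + (- (r + ?p) + t) = - r + t"
        by (simp only: minus_add add.assoc add_minus_cancel)
      ultimately show False using le_trans Suc.prems(2) by (metis add_0)
    qed
  qed auto
  ultimately show ?case by (simp only: envelope_Suc fun_upd_other simp_thms)
qed simp

text \<open>The points t + p read by the drift lie strictly above t: if t were above t + p, both p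
  and -p would be nonnegative, and antisymmetry would give p = 0. Hence the drift at t sees no
  coordinate of \<open>y t\<close>.\<close>

lemma drift_fun_upd:
  assumes "m < n"
  shows "drift C (y(t := v)) i b m t = drift C y i b m t"
  unfolding drift_def
proof (intro sum.cong refl arg_cong2[where f = "(*)"] envelope_fun_upd)
  fix j u assume ju: "j \<in> {..<n}" "u \<in> supp (g m j)"
  let ?p = "u - s j"
  show "\<not> le 0 (- (t + ?p) + t)"
  proof
    assume "le 0 (- (t + ?p) + t)"
    also have "- (t + ?p) + t = - ?p"
      by (simp only: minus_add add.assoc left_minus add.right_neutral)
    finally have "le (0 + ?p) (- ?p + ?p)" by (simp only: le_add_right_iff)
    then have "le ?p 0" by (simp only: add_0 left_minus)
    then show False using pos_shift[of m j u] ju assms le_antisym[of ?p 0] by auto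
  qed
qed auto

end

section \<open>Expected size of the envelopes\<close>

locale lopsided_pmf = lopsided n f g M s le
  for n :: nat and f g :: "nat \<Rightarrow> nat \<Rightarrow> 'g::{group_add, countable} \<Rightarrow> int" and M s le +
  fixes \<nu> :: "(nat \<Rightarrow> int) pmf"
  assumes set_nu: "set_pmf \<nu> \<subseteq> Sf n M"
    and marginal: "j < n \<Longrightarrow> map_pmf (\<lambda>v. v j) \<nu> = pmf_of_set {0..<\<bar>M j\<bar>}"
begin

lemma measurable_envelope [measurable]:
  "(\<lambda>y. real (envelope C y i b m t)) \<in> borel_measurable (nuG \<nu>)"
proof (induction i arbitrary: b m t)
  case (Suc i)
  have [measurable]: "(\<lambda>y. real (drift C y i b m t)) \<in> borel_measurable (nuG \<nu>)"
    unfolding drift_def using Suc by simp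
  have [measurable]: "(\<lambda>y. real (nat (if b then y t m else \<bar>M m\<bar> - 1 - y t m))) \<in> borel_measurable (nuG \<nu>)"
    by (rule measurable_nuG_component[where h = "\<lambda>v. real (nat (if b then v m else \<bar>M m\<bar> - 1 - v m))"])
  \<comment> \<open>Natural division is rewritten as the floor of a real quotient, which is Borel
    measurable.\<close>
  have "(\<lambda>y. real (envelope C y (Suc i) b m t)) = (\<lambda>y. of_int \<lfloor>(real (nat (if b then y t m else \<bar>M m\<bar> - 1 - y t m)) +
      real (drift C y i b m t)) / real (nat \<bar>M m\<bar>)\<rfloor>)"
    by (intro ext) (simp only: envelope_Suc floor_divide_of_nat_eq of_nat_add[symmetric] of_int_of_nat_eq)
  also have "\<dots> \<in> borel_measurable (nuG \<nu>)" by measurable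
  finally show ?case .
qed simp

text \<open>Both v_m and |M_m| - 1 - v_m are uniform, so either value of \<open>b\<close> reduces to
  Hermite's identity. This is where uniformity of the marginals enters.\<close>

lemma expectation_marginal:
  assumes "m < n"
  shows "(\<integral>\<^sup>+v. ennreal (real ((nat (if b then v m else \<bar>M m\<bar> - 1 - v m) + a) div nat \<bar>M m\<bar>)) \<partial>measure_pmf \<nu>) =
    ennreal (real a / \<bar>M m\<bar>)"
proof -
  let ?N = "nat \<bar>M m\<bar>"
  let ?h = "\<lambda>x. (nat (if b then x else \<bar>M m\<bar> - 1 - x) + a) div ?N"
  have N: "0 < ?N" using M_pos[OF assms] by simp
  have "(\<integral>\<^sup>+v. ennreal (real (?h (v m))) \<partial>measure_pmf \<nu>) = (\<integral>\<^sup>+x. ennreal (real (?h x)) \<partial>map_pmf (\<lambda>v. v m) \<nu>)"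
    by simp
  also have "\<dots> = (\<Sum>x\<in>{0..<\<bar>M m\<bar>}. ennreal (real (?h x))) / of_nat ?N"
    using N by (subst marginal[OF assms], subst nn_integral_pmf_of_set) auto
  also have "(\<Sum>x\<in>{0..<\<bar>M m\<bar>}. ennreal (real (?h x))) = ennreal (real (\<Sum>x\<in>{0..<\<bar>M m\<bar>}. ?h x))"
    by (simp add: sum_ennreal)
  also have "(\<Sum>x\<in>{0..<\<bar>M m\<bar>}. ?h x) = (\<Sum>v<?N. (v + a) div ?N)"
    by (rule sum.reindex_bij_witness[of _ "\<lambda>v. if b then int v else \<bar>M m\<bar> - 1 - int v"
          "\<lambda>x. nat (if b then x else \<bar>M m\<bar> - 1 - x)"]) auto
  also have "\<dots> = a" by (rule sum_add_div_nat[OF N])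
  also have "ennreal (real a) / of_nat ?N = ennreal (real a / \<bar>M m\<bar>)"
    unfolding ennreal_of_nat_eq_real_of_nat using N by (subst divide_ennreal) auto
  finally show ?thesis .
qed

text \<open>Integrating over \<open>y t\<close> first, the drift is constant by
  \<open>drift_fun_upd\<close>, and the integer quotient averages to exactly drift / |M_m|. Rounding
  costs nothing in the mean.\<close>

lemma expectation_envelope_Suc:
  assumes "m < n"
  shows "(\<integral>\<^sup>+y. ennreal (envelope C y (Suc i) b m t) \<partial>nuG \<nu>) =
    (\<Sum>j<n. \<Sum>u\<in>supp (g m j). ennreal (\<bar>g m j u\<bar> / \<bar>M m\<bar>) *
      (\<integral>\<^sup>+y. ennreal (envelope C y i (b = (0 < g m j u * M j)) j (t + (u - s j))) \<partial>nuG \<nu>))"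
proof -
  have "(\<integral>\<^sup>+y. ennreal (envelope C y (Suc i) b m t) \<partial>nuG \<nu>) =
      (\<integral>\<^sup>+y. (\<integral>\<^sup>+v. ennreal (envelope C (y(t := v)) (Suc i) b m t) \<partial>measure_pmf \<nu>) \<partial>nuG \<nu>)"
    by (rule nn_integral_nuG_resample) simp
  also have "\<dots> = (\<integral>\<^sup>+y. ennreal (real (drift C y i b m t) / \<bar>M m\<bar>) \<partial>nuG \<nu>)"
    unfolding envelope_Suc drift_fun_upd[OF assms] fun_upd_same expectation_marginal[OF assms] ..
  also have "(\<lambda>y. ennreal (real (drift C y i b m t) / \<bar>M m\<bar>)) =
     (\<lambda>y. \<Sum>j<n. \<Sum>u\<in>supp (g m j). ennreal (\<bar>g m j u\<bar> / \<bar>M m\<bar>) *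
       ennreal (envelope C y i (b = (0 < g m j u * M j)) j (t + (u - s j))))"
    by (simp add: drift_def sum_divide_distrib sum_ennreal sum_nonneg flip: ennreal_mult)
  also have "(\<integral>\<^sup>+y. \<dots> y \<partial>nuG \<nu>) = (\<Sum>j<n. \<Sum>u\<in>supp (g m j). ennreal (\<bar>g m j u\<bar> / \<bar>M m\<bar>) *
      (\<integral>\<^sup>+y. ennreal (envelope C y i (b = (0 < g m j u * M j)) j (t + (u - s j))) \<partial>nuG \<nu>))"
    by (simp add: nn_integral_sum nn_integral_cmult)
  finally show ?thesis .
qed

text \<open>Each step weights the previous bound by |g| / |M_m|, with total weight at most
  \<open>\<rho>\<close>; the start is the constant \<open>C\<close> on a probability space.\<close>

lemma expectation_envelope_le:
  assumes \<rho>: "0 \<le> \<rho>" "\<And>m. m < n \<Longrightarrow> (\<Sum>j<n. \<Sum>u\<in>supp (g m j). \<bar>real_of_int (g m j u)\<bar>) \<le> \<rho> * \<bar>real_of_int (M m)\<bar>"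
    and "m < n"
  shows "(\<integral>\<^sup>+y. ennreal (envelope C y i b m t) \<partial>nuG \<nu>) \<le> ennreal (C * \<rho> ^ i)"
  using \<open>m < n\<close>
proof (induction i arbitrary: b m t)
  case 0
  interpret prob_space "nuG \<nu> :: ('g \<Rightarrow> nat \<Rightarrow> int) measure"
    unfolding nuG_def by (intro prob_space_PiM measure_pmf.prob_space_axioms)
  show ?case by (simp add: emeasure_space_1)
next
  case (Suc i)
  have "(\<integral>\<^sup>+y. ennreal (envelope C y (Suc i) b m t) \<partial>nuG \<nu>) \<le>
      (\<Sum>j<n. \<Sum>u\<in>supp (g m j). ennreal (\<bar>g m j u\<bar> / \<bar>M m\<bar>) * ennreal (C * \<rho> ^ i))"
    unfolding expectation_envelope_Suc[OF Suc.prems]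
    by (intro sum_mono mult_left_mono Suc.IH) auto
  also have "\<dots> = ennreal (\<Sum>j<n. \<Sum>u\<in>supp (g m j). (\<bar>g m j u\<bar> / \<bar>M m\<bar>) * (C * \<rho> ^ i))"
    using \<rho>(1) by (simp add: sum_ennreal sum_nonneg flip: ennreal_mult)
  also have "(\<Sum>j<n. \<Sum>u\<in>supp (g m j). (\<bar>g m j u\<bar> / \<bar>M m\<bar>) * (C * \<rho> ^ i)) =
      (\<Sum>j<n. \<Sum>u\<in>supp (g m j). \<bar>real_of_int (g m j u)\<bar>) / \<bar>M m\<bar> * (C * \<rho> ^ i)"
    by (simp add: sum_distrib_right sum_divide_distrib)
  also have "\<dots> \<le> \<rho> * (C * \<rho> ^ i)"
    using \<rho>(1) \<rho>(2)[OF Suc.prems] M_pos[OF Suc.prems]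
    by (intro mult_right_mono) (auto simp: divide_le_eq)
  finally show ?case by (simp add: mult_ac ennreal_leI)
qed

end

section \<open>Measurability\<close>

text \<open>Such a set is a union of cylinders over finitely many coordinates, each open in a
  product of discrete spaces.\<close>

lemma open_finite_dependence:
  fixes Q :: "('i \<Rightarrow> 'a::discrete_topology) \<Rightarrow> bool"
  assumes "finite D" "\<And>z z'. \<forall>i\<in>D. z i = z' i \<Longrightarrow> Q z \<longleftrightarrow> Q z'"
  shows "open {z. Q z}"
proof -
  let ?cyl = "\<lambda>z :: 'i \<Rightarrow> 'a. Pi\<^sub>E UNIV (\<lambda>i. if i \<in> D then {z i} else UNIV)"
  have "open (?cyl z)" for z
  proof (rule open_PiE)
    show "open (if i \<in> D then {z i} else UNIV)" for i by (rule discrete_topology_class.open_discrete)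
    show "finite {i. (if i \<in> D then {z i} else UNIV) \<noteq> UNIV}"
      by (rule finite_subset[OF _ assms(1)]) (auto split: if_splits)
  qed
  then have "open (\<Union>z\<in>{z. Q z}. ?cyl z)" by blast
  also have "(\<Union>z\<in>{z. Q z}. ?cyl z) = {z. Q z}"
  proof (intro set_eqI iffI)
    fix w assume "w \<in> (\<Union>z\<in>{z. Q z}. ?cyl z)"
    then obtain z where "Q z" "w \<in> ?cyl z" by blast
    moreover from this(2) have "\<forall>i\<in>D. z i = w i" by (auto simp: PiE_iff split: if_splits)
    ultimately show "w \<in> {z. Q z}" using assms(2)[of z w] by simp
  qed (auto simp: PiE_iff)
  finally show ?thesis .
qed

lemma closed_finite_dependence:
  fixes Q :: "('i \<Rightarrow> 'a::discrete_topology) \<Rightarrow> bool"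
  assumes "finite D" "\<And>z z'. \<forall>i\<in>D. z i = z' i \<Longrightarrow> Q z \<longleftrightarrow> Q z'"
  shows "closed {z. Q z}"
  using open_finite_dependence[of D "\<lambda>z. \<not> Q z"] assms unfolding closed_def
  by (simp add: Collect_neg_eq)

text \<open>Tychonoff for copies of a finite integer interval.\<close>

lemma compact_box_int: "compact {z :: 'i \<Rightarrow> int. \<forall>i. \<bar>z i\<bar> \<le> C}"
proof -
  have "compactin (product_topology (\<lambda>i::'i. euclidean) UNIV) (Pi\<^sub>E UNIV (\<lambda>_. {-C..C}))"
    by (simp add: compactin_PiE finite_imp_compact)
  moreover have "\<bar>a\<bar> \<le> C \<longleftrightarrow> - C \<le> a \<and> a \<le> C" for a :: int by auto
  then have "Pi\<^sub>E UNIV (\<lambda>_. {-C..C}) = {z :: 'i \<Rightarrow> int. \<forall>i. \<bar>z i\<bar> \<le> C}"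
    by (simp add: set_eq_iff PiE_iff)
  ultimately show ?thesis by (simp add: euclidean_product_topology)
qed

text \<open>Every constraint reads finitely many coordinates and is therefore closed. The finite
  intersection property in the compact box passes from finitely many constraints to all of
  them.\<close>

lemma bounded_int_compactness:
  fixes Q :: "'r \<Rightarrow> ('i \<Rightarrow> int) \<Rightarrow> bool"
  assumes "\<And>r. finite (D r)" "\<And>r z z'. \<forall>i\<in>D r. z i = z' i \<Longrightarrow> Q r z \<longleftrightarrow> Q r z'"
    and fin: "\<And>F. finite F \<Longrightarrow> \<exists>z. (\<forall>i. \<bar>z i\<bar> \<le> C) \<and> (\<forall>r\<in>F. Q r z)"
  shows "\<exists>z. (\<forall>i. \<bar>z i\<bar> \<le> C) \<and> (\<forall>r. Q r z)"
proof -
  have "{z. \<forall>i. \<bar>z i\<bar> \<le> C} \<inter> (\<Inter>r\<in>UNIV. {z. Q r z}) \<noteq> {}"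
  proof (rule compact_imp_fip_image)
    show "closed {z. Q r z}" for r
      using assms(1,2) by (rule closed_finite_dependence)
    show "{z. \<forall>i. \<bar>z i\<bar> \<le> C} \<inter> (\<Inter>r\<in>F. {z. Q r z}) \<noteq> {}" if "finite F" for F
      using fin[OF that] by auto
  qed (rule compact_box_int)
  then show ?thesis by auto
qed

lemma finite_Sf: "finite (Sf n M)"
proof -
  have "Sf n M \<subseteq> {v. \<forall>k. (k \<in> {..<n} \<longrightarrow> v k \<in> {0..\<Sum>k<n. \<bar>M k\<bar>}) \<and> (k \<notin> {..<n} \<longrightarrow> v k = 0)}"
  proof clarify
    fix v k assume v: "v \<in> Sf n M"
    have "\<bar>M k\<bar> \<le> (\<Sum>k<n. \<bar>M k\<bar>)" if "k < n"
      using that by (intro member_le_sum) auto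
    then show "(k \<in> {..<n} \<longrightarrow> v k \<in> {0..\<Sum>k<n. \<bar>M k\<bar>}) \<and> (k \<notin> {..<n} \<longrightarrow> v k = 0)"
      using v unfolding Sf_def by force
  qed
  then show ?thesis by (rule finite_subset) (rule finite_set_of_finite_funs; simp)
qed

lemma space_nuG [simp]: "space (nuG \<nu>) = UNIV"
  by (auto simp: nuG_def space_PiM PiE_iff)

lemma sets_nuG_coordinate: "{y. y t \<in> A} \<in> sets (nuG \<nu>)"
proof -
  have "(\<lambda>y. y t) -` A \<inter> space (nuG \<nu>) \<in> sets (nuG \<nu>)"
    by (rule measurable_sets[of _ _ "measure_pmf \<nu>"]) (auto simp: nuG_def)
  then show ?thesis by (simp add: vimage_def)
qed

lemma sets_SfG: "(SfG n M :: ('g::countable \<Rightarrow> nat \<Rightarrow> int) set) \<in> sets (nuG \<nu>)"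
proof -
  have "(\<Inter>t::'g. {y. y t \<in> Sf n M}) \<in> sets (nuG \<nu>)"
    by (intro sets.countable_INT'' sets_nuG_coordinate) (use sets.top[of "nuG \<nu>"] in auto)
  also have "(\<Inter>t::'g. {y. y t \<in> Sf n M}) = SfG n M"
    by (auto simp: SfG_def)
  finally show ?thesis .
qed

text \<open>Since S_f is finite there are finitely many patterns on \<open>F\<close>, and the set is
  a finite union of their cylinders.\<close>

lemma sets_SfG_finite_dependence:
  fixes P :: "('g::countable \<Rightarrow> nat \<Rightarrow> int) \<Rightarrow> bool"
  assumes "finite F" "\<And>y y'. \<forall>r\<in>F. y r = y' r \<Longrightarrow> P y \<longleftrightarrow> P y'"
  shows "{y \<in> SfG n M. P y} \<in> sets (nuG \<nu>)"
proof -
  let ?V = "{v \<in> F \<rightarrow>\<^sub>E Sf n M. P v}"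
  let ?cyl = "\<lambda>v. SfG n M - (\<Union>r\<in>F. {y. y r \<in> - {v r}})"
  have eq: "{y \<in> SfG n M. P y} = (\<Union>v\<in>?V. ?cyl v)"
  proof (intro set_eqI iffI)
    fix y assume y: "y \<in> {y \<in> SfG n M. P y}"
    then have "restrict y F \<in> ?V"
      using assms(2)[of y "restrict y F"] by (auto simp: SfG_def)
    moreover have "y \<in> ?cyl (restrict y F)" using y by auto
    ultimately show "y \<in> (\<Union>v\<in>?V. ?cyl v)" by blast
  next
    fix y assume "y \<in> (\<Union>v\<in>?V. ?cyl v)"
    then obtain v where "P v" "y \<in> SfG n M" "\<forall>r\<in>F. y r = v r" by auto
    then show "y \<in> {y \<in> SfG n M. P y}" using assms(2)[of y v] by auto
  qed
  have "finite ?V"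
    by (rule finite_subset[of _ "F \<rightarrow>\<^sub>E Sf n M"]) (auto intro!: finite_PiE assms(1) finite_Sf)
  moreover have "?cyl v \<in> sets (nuG \<nu>)" for v
    using assms(1) by (intro sets.Diff sets_SfG sets.finite_UN sets_nuG_coordinate)
  ultimately show ?thesis unfolding eq by (rule sets.finite_UN)
qed

section \<open>Measurability of the collision sets and of \<open>phi\<close>\<close>

context lopsided
begin

text \<open>Fixing the bound \<open>C\<close> and the place (m, t) of a nonzero entry makes the
  conditions on z closed in a compact box; being nonzero at an unspecified place would only be an
  open condition.\<close>

definition collision_set :: "nat \<Rightarrow> nat \<Rightarrow> 'g \<Rightarrow> ('g \<Rightarrow> nat \<Rightarrow> int) set" where
  "collision_set C m t =
    {y \<in> SfG n M. \<exists>z. (\<forall>k t. \<bar>z k t\<bar> \<le> int C) \<and> z m t \<noteq> 0 \<and> perturb y z \<in> SfG n M}"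

text \<open>An existential over uncountably many z does not directly give a measurable set.
  Compactness replaces it by conditions indexed by finite sets, each reading finitely many
  coordinates of y.\<close>

lemma collision_set_eq_INT:
  "collision_set C m t =
    (\<Inter>F\<in>Collect finite. {y \<in> SfG n M. \<exists>z. (\<forall>k t. \<bar>z k t\<bar> \<le> int C) \<and> z m t \<noteq> 0 \<and> (\<forall>r\<in>F. perturb y z r \<in> Sf n M)})"
  (is "_ = (\<Inter>F\<in>_. ?A F)")
proof (intro subset_antisym subsetI)
  fix y assume "y \<in> collision_set C m t"
  then obtain z where z: "y \<in> SfG n M" "\<forall>k t. \<bar>z k t\<bar> \<le> int C" "z m t \<noteq> 0" "perturb y z \<in> SfG n M"
    unfolding collision_set_def by blast
  from z(4) have "\<forall>r. perturb y z r \<in> Sf n M" by (simp add: SfG_def Pi_iff)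
  with z(1-3) show "y \<in> (\<Inter>F\<in>Collect finite. ?A F)"
    by (intro INT_I CollectI conjI exI[of _ z]) auto
next
  fix y assume y: "y \<in> (\<Inter>F\<in>Collect finite. ?A F)"
  let ?c = "\<lambda>z k t. z (k, t)"
  let ?Q = "\<lambda>r z. ?c z m t \<noteq> 0 \<and> perturb y (?c z) r \<in> Sf n M"
  \<comment> \<open>The entries of z that z F reads at r, together with the entry required to be
    nonzero; double indices are merged into pairs so that z is a point of one product space.\<close>
  let ?D = "\<lambda>r. insert (m, t) (\<Union>k<n. \<Union>j<n. (\<lambda>u. (j, r + u)) ` supp (f k j))"
  have "\<exists>z. (\<forall>i. \<bar>z i\<bar> \<le> int C) \<and> (\<forall>r. ?Q r z)"
  proof (rule bounded_int_compactness)
    show "finite (?D r)" for r using finite_supp by auto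
    show "?Q r z \<longleftrightarrow> ?Q r z'" if eq: "\<forall>i\<in>?D r. z i = z' i" for r z z'
    proof -
      have "right_star n f (?c z) k r = right_star n f (?c z') k r" if "k < n" for k
        unfolding right_star_def using that eq
        by (intro sum.cong refl arg_cong2[where f = "(*)"]) blast
      then have "perturb y (?c z) r = perturb y (?c z') r" by (simp add: perturb_def fun_eq_iff)
      then show ?thesis using eq by simp
    qed
    show "\<exists>z. (\<forall>i. \<bar>z i\<bar> \<le> int C) \<and> (\<forall>r\<in>F. ?Q r z)" if "finite F" for F
    proof -
      have "y \<in> ?A F" using y that by blast
      then obtain z where "\<forall>k t. \<bar>z k t\<bar> \<le> int C" "z m t \<noteq> 0" "\<forall>r\<in>F. perturb y z r \<in> Sf n M"
        by blast
      then show ?thesis by (intro exI[of _ "case_prod z"]) auto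
    qed
  qed
  then obtain z where "\<forall>i. \<bar>z i\<bar> \<le> int C" "\<forall>r. ?Q r z" by blast
  moreover have "y \<in> SfG n M" using y finite.emptyI by blast
  ultimately show "y \<in> collision_set C m t"
    unfolding collision_set_def SfG_def by (intro CollectI conjI exI[of _ "?c z"]) auto
qed

lemma sets_collision_set: "collision_set C m t \<in> sets (nuG \<nu>)"
  unfolding collision_set_eq_INT
proof (rule sets.countable_INT')
  show "(\<lambda>F. {y \<in> SfG n M. \<exists>z. (\<forall>k t. \<bar>z k t\<bar> \<le> int C) \<and> z m t \<noteq> 0 \<and> (\<forall>r\<in>F. perturb y z r \<in> Sf n M)}) `
      Collect finite \<subseteq> sets (nuG \<nu>)"
  proof (intro image_subsetI sets_SfG_finite_dependence)
    fix F :: "'g set" and y y' :: "'g \<Rightarrow> nat \<Rightarrow> int" assume "\<forall>r\<in>F. y r = y' r"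
    then have "perturb y z r = perturb y' z r" if "r \<in> F" for z r
      using that by (simp add: perturb_def fun_eq_iff)
    then show "(\<exists>z. (\<forall>k t. \<bar>z k t\<bar> \<le> int C) \<and> z m t \<noteq> 0 \<and> (\<forall>r\<in>F. perturb y z r \<in> Sf n M)) \<longleftrightarrow>
        (\<exists>z. (\<forall>k t. \<bar>z k t\<bar> \<le> int C) \<and> z m t \<noteq> 0 \<and> (\<forall>r\<in>F. perturb y' z r \<in> Sf n M))"
      by simp
  qed simp
qed (auto intro: countable_Collect_finite)

text \<open>Countably many choices of bound and place exhaust all bounded nonzero integer
  directions.\<close>

lemma phi_collisions_eq_UN:
  "{y \<in> SfG n M. \<exists>y'\<in>SfG n M. y' \<noteq> y \<and> phi n f y' = phi n f y} = (\<Union>C. \<Union>m<n. \<Union>t. collision_set C m t)"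
  (is "?L = ?R")
proof (rule set_eqI)
  fix y
  show "y \<in> ?L \<longleftrightarrow> y \<in> ?R"
  proof (cases "y \<in> SfG n M")
    case True
    then have "y \<in> ?L \<longleftrightarrow> (\<exists>z C. (\<forall>k t. \<bar>z k t\<bar> \<le> int C) \<and> (\<exists>k<n. \<exists>t. z k t \<noteq> 0) \<and> perturb y z \<in> SfG n M)"
      using phi_collision_iff[OF True] by simp
    also have "\<dots> \<longleftrightarrow> (\<exists>C. \<exists>m<n. \<exists>t. y \<in> collision_set C m t)"
      using True unfolding collision_set_def by (simp only: mem_Collect_eq simp_thms) blast
    also have "\<dots> \<longleftrightarrow> y \<in> ?R" by auto
    finally show ?thesis .
  qed (simp add: collision_set_def)
qed

text \<open>Enumerating the group turns the convolution into a series of measurable functions. It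
  converges to the convolution on \<open>SfG n M\<close>, where configurations are bounded.\<close>

lemma measurable_conv:
  assumes "k < n" "m < n"
  shows "(\<lambda>y. conv (emb y k) (B k m) t) \<in> borel_measurable (restrict_space (nuG \<nu>) (SfG n M))"
proof -
  \<comment> \<open>Numbers that encode no group element contribute 0.\<close>
  let ?F = "\<lambda>y i. if i \<in> range (to_nat :: 'g \<Rightarrow> nat) then emb y k (t - from_nat i) * B k m (from_nat i) else 0"
  have "conv (emb y k) (B k m) t = (\<Sum>i. ?F y i)" if "y \<in> SfG n M" for y
  proof -
    have "((\<lambda>s. emb y k (t - s) * B k m s) has_sum conv (emb y k) (B k m) t) UNIV"
      by (rule has_sum_conv(1)[OF emb_bounded[OF that] l1_finv[OF assms]])
    then have "((\<lambda>i. emb y k (t - from_nat i) * B k m (from_nat i)) has_sum conv (emb y k) (B k m) t) (range (to_nat :: 'g \<Rightarrow> nat))"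
      by (subst has_sum_reindex) (auto simp: o_def)
    then have "(?F y has_sum conv (emb y k) (B k m) t) UNIV"
      by (rule has_sum_cong_neutral[THEN iffD1, rotated -1]) auto
    then show ?thesis by (simp add: has_sum_imp_sums sums_unique)
  qed
  then have *: "conv (emb y k) (B k m) t = (\<Sum>i. ?F y i)" if "y \<in> space (restrict_space (nuG \<nu>) (SfG n M))" for y
    using that by (simp add: space_restrict_space)
  have "(\<lambda>y. ?F y i) \<in> borel_measurable (nuG \<nu>)" for i
    using measurable_nuG_component[where h = "\<lambda>v. real_of_int (v k) * B k m (from_nat i)" and t = "t - from_nat i"]
    by (cases "i \<in> range (to_nat :: 'g \<Rightarrow> nat)") simp_all
  then have "(\<lambda>y. \<Sum>i. ?F y i) \<in> borel_measurable (restrict_space (nuG \<nu>) (SfG n M))"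
    by (intro borel_measurable_suminf measurable_restrict_space1)
  then show ?thesis by (subst measurable_cong[OF *])
qed

lemma measurable_phi: "phi n f \<in> measurable (restrict_space (nuG \<nu>) (SfG n M)) targetM"
  unfolding targetM_def
proof (intro measurable_PiM_single')
  show "(\<lambda>y. phi n f y m t) \<in> borel_measurable (restrict_space (nuG \<nu>) (SfG n M))" for m t
  proof (cases "m < n")
    case True
    have [measurable]: "(\<lambda>y. act (emb y) m t) \<in> borel_measurable (restrict_space (nuG \<nu>) (SfG n M))"
      unfolding act_def using True by (intro borel_measurable_sum measurable_conv) auto
    show ?thesis using True unfolding phi_eq frac_def by simp
  qed (simp add: phi_eq)
qed (auto simp: PiE_iff space_PiM)

end

section \<open>Collisions have measure zero\<close>

context lopsided_pmf
begin

text \<open>A nonzero integer entry has one of two signs, so on the collision set the envelopes for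
  both signs add up to at least 1. Their expectations tend to 0 with the number of
  iterations.\<close>

lemma null_sets_collision_set:
  assumes "m < n"
  shows "collision_set C m t \<in> null_sets (nuG \<nu>)"
proof -
  obtain \<rho> where \<rho>: "0 \<le> \<rho>" "\<rho> < 1"
    "\<And>m. m < n \<Longrightarrow> (\<Sum>j<n. \<Sum>u\<in>supp (g m j). \<bar>real_of_int (g m j u)\<bar>) \<le> \<rho> * \<bar>real_of_int (M m)\<bar>"
    using contraction_factor by blast
  \<comment> \<open>An envelope at a point r bounds the entry at r + s_m, hence the base point
    \<open>t - s m\<close> for the entry at t.\<close>
  let ?U = "\<lambda>i b y. ennreal (envelope C y i b m (t - s m))"
  have le: "emeasure (nuG \<nu>) (collision_set C m t) \<le> ennreal (2 * real C * \<rho> ^ i)" for i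
  proof -
    have "indicator (collision_set C m t) y \<le> ?U i True y + ?U i False y" for y
    proof (cases "y \<in> collision_set C m t")
      case True
      then obtain z where z: "\<And>k t. \<bar>z k t\<bar> \<le> int C" "z m t \<noteq> 0" and y: "y \<in> SfG n M" "perturb y z \<in> SfG n M"
        unfolding collision_set_def by blast
      have "sgn (M m) * z m t \<noteq> 0" using z(2) M_pos[OF assms] by (simp add: sgn_if)
      moreover have "sgn (M m) * z m t \<le> int (envelope C y i True m (t - s m))"
        using envelope_dominates[OF y z(1) assms, of True "t - s m" i] by simp
      moreover have "- (sgn (M m) * z m t) \<le> int (envelope C y i False m (t - s m))"
        using envelope_dominates[OF y z(1) assms, of False "t - s m" i] by simp
      ultimately have "1 \<le> envelope C y i True m (t - s m) + envelope C y i False m (t - s m)"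
        by linarith
      then have "1 \<le> ennreal (real (envelope C y i True m (t - s m) + envelope C y i False m (t - s m)))"
        by (metis ennreal_1 ennreal_leI of_nat_1 of_nat_le_iff)
      then show ?thesis using True by simp
    qed simp
    then have "(\<integral>\<^sup>+y. indicator (collision_set C m t) y \<partial>nuG \<nu>) \<le> (\<integral>\<^sup>+y. ?U i True y + ?U i False y \<partial>nuG \<nu>)"
      by (intro nn_integral_mono)
    also have "\<dots> = (\<integral>\<^sup>+y. ?U i True y \<partial>nuG \<nu>) + (\<integral>\<^sup>+y. ?U i False y \<partial>nuG \<nu>)"
      by (rule nn_integral_add) auto
    also have "\<dots> \<le> ennreal (C * \<rho> ^ i) + ennreal (C * \<rho> ^ i)"
      by (intro add_mono expectation_envelope_le \<rho> assms)
    also have "\<dots> = ennreal (2 * real C * \<rho> ^ i)"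
      using \<rho>(1) by (simp flip: ennreal_plus)
    finally show ?thesis by (simp add: sets_collision_set)
  qed
  have "(\<lambda>i. ennreal (2 * real C * \<rho> ^ i)) \<longlonglongrightarrow> ennreal (2 * real C * 0)"
    by (rule tendsto_ennrealI, rule tendsto_mult_left, rule LIMSEQ_power_zero) (use \<rho> in simp)
  then have "emeasure (nuG \<nu>) (collision_set C m t) \<le> ennreal (2 * real C * 0)"
    by (rule LIMSEQ_le_const) (use le in blast)
  then show ?thesis by (simp add: null_sets_def sets_collision_set)
qed

lemma null_sets_phi_collisions:
  "{y \<in> SfG n M. \<exists>y'\<in>SfG n M. y' \<noteq> y \<and> phi n f y' = phi n f y} \<in> null_sets (nuG \<nu>)"
  unfolding phi_collisions_eq_UN by (intro null_sets_UN' null_sets_collision_set) auto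

lemma AE_SfG: "AE y in nuG \<nu>. y \<in> (SfG n M :: ('g \<Rightarrow> nat \<Rightarrow> int) set)"
proof -
  have "AE y in nuG \<nu>. y t \<in> Sf n M" for t :: 'g
    unfolding nuG_def using set_nu
    by (intro AE_PiM_component measure_pmf.prob_space_axioms) (auto simp: AE_measure_pmf_iff)
  then have "AE y in nuG \<nu>. \<forall>t::'g. y t \<in> Sf n M" by (simp add: AE_all_countable)
  then show ?thesis by (simp add: SfG_def Pi_iff)
qed

end

theorem theorem1p1:
  fixes n :: nat
    and f g :: "nat \<Rightarrow> nat \<Rightarrow> 'g::{group_add, countable} \<Rightarrow> int"
    and M :: "nat \<Rightarrow> int" and s :: "nat \<Rightarrow> 'g" and le :: "'g \<Rightarrow> 'g \<Rightarrow> bool"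
    and \<nu> :: "(nat \<Rightarrow> int) pmf"
  assumes "infinite (UNIV :: 'g set)"
    and "pos_row_lopsided n f M s g le"
    and "set_pmf \<nu> \<subseteq> Sf n M"
    and "\<forall>j<n. map_pmf (\<lambda>v. v j) \<nu> = pmf_of_set {0..<\<bar>M j\<bar>}"
  shows "({y \<in> SfG n M. \<exists>y'\<in>SfG n M. y' \<noteq> y \<and> phi n f y' = phi n f y} \<in> null_sets (nuG \<nu>)) \<and>
    phi n f \<in> measurable (restrict_space (nuG \<nu>) (SfG n M)) targetM \<and>
    phi n f ` SfG n M \<subseteq> Xf n f \<and>
    (\<forall>\<gamma>. \<forall>y\<in>SfG n M. phi n f (shiftY \<gamma> y) = shiftX \<gamma> (phi n f y)) \<and>
    (\<exists>A. A \<subseteq> SfG n M \<and> A \<in> sets (nuG \<nu>) \<and> (AE y in nuG \<nu>. y \<in> A) \<and>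
           (\<forall>\<gamma>. \<forall>y\<in>A. shiftY \<gamma> y \<in> A) \<and> inj_on (phi n f) A)"
proof -
  interpret lopsided_pmf n f g M s le \<nu>
    using assms(2-4) by (simp add: lopsided_pmf_def lopsided_def lopsided_pmf_axioms_def)
  let ?N = "{y \<in> SfG n M. \<exists>y'\<in>SfG n M. y' \<noteq> y \<and> phi n f y' = phi n f y}"
  \<comment> \<open>All members of every collision are removed, not all but one, so injectivity is
    immediate and the set can be shift invariant.\<close>
  let ?A = "SfG n M - ?N"
  have shift_SfG: "shiftY \<gamma> y \<in> SfG n M" if "y \<in> SfG n M" for \<gamma> and y :: "'g \<Rightarrow> nat \<Rightarrow> int"
    using that by (auto simp: SfG_def shiftY_def)
  have shift_inv: "shiftY (- \<gamma>) (shiftY \<gamma> y) = y" for \<gamma> and y :: "'g \<Rightarrow> nat \<Rightarrow> int"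
    by (simp add: shiftY_def fun_eq_iff add.assoc[symmetric])
  \<comment> \<open>By equivariance a collision of the shifted configuration shifts back to a
    collision of y.\<close>
  have "shiftY \<gamma> y \<in> ?A" if y: "y \<in> ?A" for \<gamma> y
  proof -
    have "shiftY \<gamma> y \<notin> ?N"
    proof
      assume "shiftY \<gamma> y \<in> ?N"
      then obtain y' where y': "y' \<in> SfG n M" "y' \<noteq> shiftY \<gamma> y" "phi n f y' = phi n f (shiftY \<gamma> y)" by blast
      have "phi n f (shiftY (- \<gamma>) y') = phi n f y"
        using y'(3) phi_shiftY[of "- \<gamma>" y'] phi_shiftY[of "- \<gamma>" "shiftY \<gamma> y"] shift_inv by simp
      then have "shiftY (- \<gamma>) y' = y" using y shift_SfG[OF y'(1)] by blast
      then show False using y'(2) shift_inv[of "- \<gamma>" y'] by simp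
    qed
    then show ?thesis using y shift_SfG by blast
  qed
  moreover have "?A \<in> sets (nuG \<nu>)"
    using null_sets_phi_collisions by (intro sets.Diff sets_SfG) (rule null_setsD2)
  moreover have "AE y in nuG \<nu>. y \<in> ?A"
    using AE_SfG AE_not_in[OF null_sets_phi_collisions] by eventually_elim blast
  moreover have "inj_on (phi n f) ?A" by (rule inj_onI) blast
  ultimately have "\<exists>A. A \<subseteq> SfG n M \<and> A \<in> sets (nuG \<nu>) \<and> (AE y in nuG \<nu>. y \<in> A) \<and>
           (\<forall>\<gamma>. \<forall>y\<in>A. shiftY \<gamma> y \<in> A) \<and> inj_on (phi n f) A"
    by (intro exI[of _ ?A]) blast
  then show ?thesis
    using null_sets_phi_collisions measurable_phi phi_in_Xf phi_shiftY by blast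
qed

end
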